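(* Let $0\le\alpha\le 1$, and let $\mathcal{B}=\{b_n\}_{n=1}^\infty$ and $\mathcal{D}=\{d_n\}_{n=1}^\infty$ be sequences of positive integers such that $1<d_n<b_n$ and $2\le b_n/d_n\in\mathbb{Z}$ for all $n\ge 1$, $$\lim_{n\to\infty}d_n=+\infty\quad\text{and}\quad \lim_{n\to\infty}\frac{\ln d_n}{\ln b_n}=\alpha.$$ Then the Riesz product measure $\mu_{\mathcal{B},\mathcal{D}}$ is a spectral measure with Hausdorff dimension $\alpha$.
   Context: Set $\rho_1:=1$ and $\rho_n:=\prod_{j=1}^{n-1}b_j$ for $n\ge 2$. The Fourier transform of a probability measure $\mu$ on $\mathbb{R}$ is $\hat\mu(\xi):=\int_{\mathbb{R}}e^{-2\pi i\xi x}\,d\mu(x)$. For $m\ge 1$ let $H_m(\xi):=\frac1m\sum_{j=0}^{m-1}e^{-2\pi i j\xi}$. The Riesz product measure $\mu_{\mathcal{B},\mathcal{D}}$ is the compactly supported probability measure on $\mathbb{R}$ defined by $$\widehat{\mu_{\mathcal{B},\mathcal{D}}}(\xi)=\prod_{n=1}^\infty H_{d_n}\Big(\frac{\xi}{d_n\rho_n}\Big).$$ A compactly supported probability measure $\mu$ is a spectral measure if there exists a countable set $\Lambda\subset\mathbb{R}$ (called a spectrum) such that $\{e^{-2\pi i\lambda x}:\lambda\in\Lambda\}$ forms an orthonormal basis for $L^2(\mu)$. The Hausdorff dimension of a probability measure $\mu$ is $\dim_H(\mu):=\inf\{\dim_H(E):\mu(E)=1\}$, where $\dim_H(E)$ is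 the Hausdorff dimension of the set $E$. *)

theory Defs
  imports "HOL-Probability.Probability"
begin

definition expo :: "real \<Rightarrow> real \<Rightarrow> complex" where
  "expo \<xi> x = exp (- 2 * of_real pi * \<i> * of_real \<xi> * of_real x)"

definition fourier_transform :: "real measure \<Rightarrow> real \<Rightarrow> complex" where
  "fourier_transform \<mu> \<xi> = (CLINT x|\<mu>. expo \<xi> x)"

definition compactly_supported :: "real measure \<Rightarrow> bool" where
  "compactly_supported \<mu> \<longleftrightarrow> (\<exists>K. compact K \<and> (AE x in \<mu>. x \<in> K))"

definition square_integrable :: "real measure \<Rightarrow> (real \<Rightarrow> complex) \<Rightarrow> bool" where
  "square_integrable \<mu> f \<longleftrightarrow> f \<in> borel_measurable \<mu> \<and> integrable \<mu> (\<lambda>x. (cmod (f x))\<^sup>2)"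

definition L2_inner :: "real measure \<Rightarrow> (real \<Rightarrow> complex) \<Rightarrow> (real \<Rightarrow> complex) \<Rightarrow> complex" where
  "L2_inner \<mu> f g = (CLINT x|\<mu>. f x * cnj (g x))"

text \<open>
  The space \<open>L\<^sup>2(\<mu>)\<close> is represented by square-integrable functions, without passing to the
  quotient modulo null sets. The family \<open>e\<close> indexed by \<open>\<Lambda>\<close> is an orthonormal basis if it is
  orthonormal and its linear span is dense with respect to the \<open>L\<^sup>2\<close> norm.
\<close>

definition L2_orthonormal_basis ::
    "real measure \<Rightarrow> 'i set \<Rightarrow> ('i \<Rightarrow> real \<Rightarrow> complex) \<Rightarrow> bool" where
  "L2_orthonormal_basis \<mu> \<Lambda> e \<longleftrightarrow>
     (\<forall>i\<in>\<Lambda>. square_integrable \<mu> (e i)) \<and>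
     (\<forall>i\<in>\<Lambda>. \<forall>j\<in>\<Lambda>. L2_inner \<mu> (e i) (e j) = (if i = j then 1 else 0)) \<and>
     (\<forall>f. square_integrable \<mu> f \<longrightarrow>
        (\<forall>\<epsilon>>0. \<exists>F c. finite F \<and> F \<subseteq> \<Lambda> \<and>
           (LINT x|\<mu>. (cmod (f x - (\<Sum>i\<in>F. c i * e i x)))\<^sup>2) < \<epsilon>))"

definition is_spectrum :: "real measure \<Rightarrow> real set \<Rightarrow> bool" where
  "is_spectrum \<mu> \<Lambda> \<longleftrightarrow> countable \<Lambda> \<and> L2_orthonormal_basis \<mu> \<Lambda> expo"

definition spectral_measure :: "real measure \<Rightarrow> bool" where
  "spectral_measure \<mu> \<longleftrightarrow>
     real_distribution \<mu> \<and> compactly_supported \<mu> \<and> (\<exists>\<Lambda>. is_spectrum \<mu> \<Lambda>)"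

text \<open>
  \<open>diam_powr s U\<close> is \<open>(diam U)\<^sup>s\<close> with the usual conventions that it is \<open>0\<close> for empty \<open>U\<close>
  and \<open>1\<close> for nonempty \<open>U\<close> when \<open>s = 0\<close>; the case distinction is needed because \<open>0 powr 0 = 0\<close>.
\<close>

definition diam_powr :: "real \<Rightarrow> 'a::metric_space set \<Rightarrow> ennreal" where
  "diam_powr s U =
     (if U = {} then 0 else if s = 0 then 1 else ennreal (diameter U powr s))"

text \<open>
  The sets of a cover are explicitly required to be bounded, since \<^const>\<open>diameter\<close> is a real
  number that is unspecified on unbounded sets.
\<close>

definition hausdorff_pre :: "real \<Rightarrow> real \<Rightarrow> 'a::metric_space set \<Rightarrow> ennreal" where
  "hausdorff_pre s \<delta> E =
     Inf {\<Sum>n. diam_powr s (U n) | U :: nat \<Rightarrow> 'a set.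
            E \<subseteq> (\<Union>n. U n) \<and> (\<forall>n. bounded (U n) \<and> diameter (U n) \<le> \<delta>)}"

definition hausdorff_measure :: "real \<Rightarrow> 'a::metric_space set \<Rightarrow> ennreal" where
  "hausdorff_measure s E = (SUP \<delta>\<in>{0<..}. hausdorff_pre s \<delta> E)"

definition hausdorff_dim :: "'a::metric_space set \<Rightarrow> ennreal" where
  "hausdorff_dim E = Inf {ennreal s | s. 0 \<le> s \<and> hausdorff_measure s E = 0}"

definition hausdorff_dim_measure :: "real measure \<Rightarrow> ennreal" where
  "hausdorff_dim_measure \<mu> = Inf {hausdorff_dim E | E. E \<in> sets \<mu> \<and> emeasure \<mu> E = 1}"

text \<open>
  The sequences \<open>b\<close> and \<open>d\<close> are indexed from \<open>1\<close>; their values at \<open>0\<close> are irrelevant.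
  Note that \<open>(has_prod)\<close> allows finitely many vanishing factors, in which case the product is \<open>0\<close>.
\<close>

definition rho :: "(nat \<Rightarrow> nat) \<Rightarrow> nat \<Rightarrow> nat" where
  "rho b n = (\<Prod>j=1..<n. b j)"

definition H_avg :: "nat \<Rightarrow> real \<Rightarrow> complex" where
  "H_avg m \<xi> = (1 / of_nat m) * (\<Sum>j<m. expo (real j) \<xi>)"

definition is_riesz_product_measure ::
    "(nat \<Rightarrow> nat) \<Rightarrow> (nat \<Rightarrow> nat) \<Rightarrow> real measure \<Rightarrow> bool" where
  "is_riesz_product_measure b d \<mu> \<longleftrightarrow>
     real_distribution \<mu> \<and> compactly_supported \<mu> \<and>
     (\<forall>\<xi>. (\<lambda>k. H_avg (d (Suc k)) (\<xi> / (real (d (Suc k)) * real (rho b (Suc k)))))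
            has_prod fourier_transform \<mu> \<xi>)"

definition riesz_product_measure :: "(nat \<Rightarrow> nat) \<Rightarrow> (nat \<Rightarrow> nat) \<Rightarrow> real measure" where
  "riesz_product_measure b d = (THE \<mu>. is_riesz_product_measure b d \<mu>)"

text \<open>
  The defining conditions determine the measure uniquely: it is the law of the random series
  \<open>\<Sum>n. X n / (d n * rho b n)\<close> with independent \<open>X n\<close> uniform on \<open>{0..<d n}\<close>.
\<close>

lemma expo_eq_iexp: "expo \<xi> x = iexp ((- 2 * pi * \<xi>) * x)"
  by (simp add: expo_def mult_ac)

lemma fourier_transform_eq_char: "fourier_transform \<mu> \<xi> = char \<mu> (- 2 * pi * \<xi>)"
  by (simp add: fourier_transform_def char_def expo_eq_iexp)

lemma borel_measurable_expo [measurable]: "expo \<xi> \<in> borel_measurable borel"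
  unfolding expo_def by measurable

lemma norm_expo_minus_one_le: "norm (expo \<xi> x - 1) \<le> 2 * pi * \<bar>\<xi> * x\<bar>"
  using iexp_approx1[of "(- 2 * pi * \<xi>) * x" 0] unfolding expo_eq_iexp
  by (simp add: abs_mult mult_ac)

lemma norm_H_avg_minus_one_le:
  assumes "m \<ge> 1"
  shows "norm (H_avg m \<xi> - 1) \<le> 2 * pi * real m * \<bar>\<xi>\<bar>"
proof -
  have eq: "H_avg m \<xi> - 1 = (1 / of_nat m) * (\<Sum>j<m. expo (real j) \<xi> - 1)"
    using assms by (simp add: H_avg_def sum_subtractf field_simps)
  have "norm (\<Sum>j<m. expo (real j) \<xi> - 1) \<le> (\<Sum>j<m. 2 * pi * real m * \<bar>\<xi>\<bar>)"
  proof (rule sum_norm_le)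
    fix j assume "j \<in> {..<m}"
    then have "2 * pi * \<bar>real j * \<xi>\<bar> \<le> 2 * pi * real m * \<bar>\<xi>\<bar>"
      by (simp add: abs_mult mult_right_mono)
    then show "norm (expo (real j) \<xi> - 1) \<le> 2 * pi * real m * \<bar>\<xi>\<bar>"
      by (rule order_trans[OF norm_expo_minus_one_le])
  qed
  then show ?thesis
    using assms unfolding eq by (simp add: norm_mult norm_divide field_simps)
qed

lemma (in product_prob_space) indep_vars_coordinates:
  assumes "I \<noteq> {}"
  shows "prob_space.indep_vars (PiM I M) M (\<lambda>i \<omega>. \<omega> i) I"
proof -
  interpret P: prob_space "PiM I M"
    by (intro prob_space_PiM M.prob_space_axioms)
  have "distr (PiM I M) (PiM I M) (\<lambda>x. \<lambda>i\<in>I. x i) = distr (PiM I M) (PiM I M) (\<lambda>x. x)"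
    by (intro distr_cong) (auto simp: space_PiM PiE_restrict)
  also have "\<dots> = (\<Pi>\<^sub>M i\<in>I. distr (PiM I M) (M i) (\<lambda>\<omega>. \<omega> i))"
    by (simp add: PiM_component cong: PiM_cong)
  finally show ?thesis
    using assms by (subst P.indep_vars_iff_distr_eq_PiM') auto
qed

lemma riesz_product_measure_exists:
  assumes d: "\<And>n. n \<ge> 1 \<Longrightarrow> d n \<ge> 1" and b: "\<And>n. n \<ge> 1 \<Longrightarrow> b n \<ge> 2"
  shows "\<exists>\<mu>. is_riesz_product_measure b d \<mu>"
proof -
  define D where "D k = real (d (Suc k)) * real (rho b (Suc k))" for k
  define p where "p k = measure_pmf (pmf_of_set {..<d (Suc k)})" for k
  define P where "P = PiM (UNIV :: nat set) p"
  define Y where "Y k i = real (i mod d (Suc k)) / D k" for k i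
  define X where "X k \<omega> = Y k (\<omega> k)" for k and \<omega> :: "nat \<Rightarrow> nat"
  define S where "S \<omega> = (\<Sum>k. X k \<omega>)" for \<omega>
  have dpos: "d (Suc k) > 0" for k
    using d[of "Suc k"] by simp
  have rho_ge: "2 ^ k \<le> rho b (Suc k)" for k
  proof (induction k)
    case (Suc k)
    have "(2::nat) ^ k * 2 \<le> rho b (Suc k) * b (Suc k)"
      using Suc b[of "Suc k"] by (intro mult_mono) auto
    then show ?case by (simp add: rho_def mult.commute)
  qed (simp add: rho_def)
  then have rho_ge': "2 ^ k \<le> real (rho b (Suc k))" for k
    using of_nat_le_iff[of "2 ^ k" "rho b (Suc k)", where ?'a = real] by simp
  have rho_pos: "real (rho b (Suc k)) > 0" for k
    using rho_ge'[of k] by (rule less_le_trans[rotated]) simp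
  have Dpos: "D k > 0" for k
    unfolding D_def using dpos rho_pos by simp
  have inv_rho: "1 / real (rho b (Suc k)) \<le> (1 / 2) ^ k" for k
    using rho_ge'[of k] rho_pos[of k] by (simp add: field_simps power_divide)
  have Y_nonneg: "0 \<le> Y k i" for k i
    unfolding Y_def using Dpos[of k] by simp
  have Y_le: "Y k i \<le> (1 / 2) ^ k" for k i
  proof -
    have "Y k i \<le> real (d (Suc k)) / D k"
      unfolding Y_def using Dpos[of k] dpos[of k]
      by (intro divide_right_mono) (auto intro: less_imp_le)
    also have "\<dots> = 1 / real (rho b (Suc k))"
      unfolding D_def using dpos[of k] by simp
    finally show ?thesis using inv_rho[of k] by simp
  qed
  have geo: "summable (\<lambda>k. (1 / 2 :: real) ^ k)"
    by (rule summable_geometric) simp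
  have X_summable: "summable (\<lambda>k. X k \<omega>)" for \<omega>
    by (rule summable_comparison_test[OF _ geo]) (auto simp: X_def Y_nonneg Y_le)
  have S_bounds: "S \<omega> \<in> {0..2}" for \<omega>
  proof -
    have "S \<omega> \<le> (\<Sum>k. (1 / 2 :: real) ^ k)"
      unfolding S_def by (intro suminf_le X_summable geo) (auto simp: X_def Y_le)
    also have "\<dots> = 2" by (subst suminf_geometric) auto
    finally show ?thesis
      unfolding S_def using X_summable by (auto intro!: suminf_nonneg simp: X_def Y_nonneg)
  qed

  have p_prob: "prob_space (p k)" for k
    unfolding p_def by (rule prob_space_measure_pmf)
  interpret PP: product_prob_space p UNIV
    by (intro product_prob_spaceI p_prob)
  interpret P: prob_space P
    unfolding P_def by (intro prob_space_PiM p_prob)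
  have coord_meas: "(\<lambda>\<omega>. \<omega> k) \<in> measurable P (p k)" for k
    unfolding P_def by (rule measurable_component_singleton) simp
  have Y_meas: "f \<in> borel_measurable (p k)" for f :: "nat \<Rightarrow> 'c::topological_space" and k
    unfolding p_def by simp
  have X_meas [measurable]: "X k \<in> borel_measurable P" for k
    unfolding X_def by (rule measurable_compose[OF coord_meas Y_meas])
  have S_meas [measurable]: "S \<in> borel_measurable P"
    unfolding S_def by measurable
  have indep: "P.indep_vars (\<lambda>_. borel) X UNIV"
  proof -
    have "P.indep_vars p (\<lambda>i \<omega>. \<omega> i) UNIV"
      unfolding P_def by (rule PP.indep_vars_coordinates) simp
    then show ?thesis
      unfolding X_def by (rule P.indep_vars_compose2) (simp add: p_def)
  qed
  define \<mu> where "\<mu> = distr P borel S"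
  interpret \<mu>: real_distribution \<mu>
    unfolding \<mu>_def by (intro P.real_distribution_distr S_meas)

  have factor: "fourier_transform (distr P borel (X k)) \<xi> = H_avg (d (Suc k)) (\<xi> / D k)" for k \<xi>
  proof -
    let ?A = "{..<d (Suc k)}"
    have ne: "?A \<noteq> {}" using dpos[of k] by auto
    have "fourier_transform (distr P borel (X k)) \<xi> = (CLINT \<omega>|P. expo \<xi> (X k \<omega>))"
      unfolding fourier_transform_def by (rule integral_distr) auto
    also have "\<dots> = (CLINT \<omega>|P. expo \<xi> (Y k (\<omega> k)))"
      by (simp add: X_def)
    also have "\<dots> = (CLINT i|distr P (p k) (\<lambda>\<omega>. \<omega> k). expo \<xi> (Y k i))"
      by (rule integral_distr[symmetric]) (rule coord_meas Y_meas)+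
    also have "distr P (p k) (\<lambda>\<omega>. \<omega> k) = p k"
      unfolding P_def by (rule PP.PiM_component) simp
    also have "(CLINT i|p k. expo \<xi> (Y k i)) =
        (\<Sum>i\<in>?A. pmf (pmf_of_set ?A) i *\<^sub>R expo \<xi> (Y k i))"
      unfolding p_def using ne by (subst integral_measure_pmf[of ?A]) auto
    also have "\<dots> = (\<Sum>i\<in>?A. (1 / of_nat (d (Suc k))) * expo (real i) (\<xi> / D k))"
      using ne by (intro sum.cong) (auto simp: Y_def expo_def scaleR_conv_of_real mult_ac)
    finally show ?thesis by (simp add: H_avg_def sum_distrib_left)
  qed

  have prod: "(\<lambda>k. H_avg (d (Suc k)) (\<xi> / D k)) has_prod fourier_transform \<mu> \<xi>" for \<xi>
  proof -
    let ?h = "\<lambda>k. H_avg (d (Suc k)) (\<xi> / D k)"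
    have "norm (?h k - 1) \<le> 2 * pi * \<bar>\<xi>\<bar> * (1 / 2) ^ k" for k
    proof -
      have "norm (?h k - 1) \<le> 2 * pi * real (d (Suc k)) * \<bar>\<xi> / D k\<bar>"
        by (rule norm_H_avg_minus_one_le) (use dpos[of k] in simp)
      also have "\<dots> = 2 * pi * \<bar>\<xi>\<bar> * (1 / real (rho b (Suc k)))"
        unfolding D_def using dpos[of k] rho_pos[of k] by (simp add: abs_mult field_simps)
      also have "\<dots> \<le> 2 * pi * \<bar>\<xi>\<bar> * (1 / 2) ^ k"
        by (intro mult_left_mono inv_rho) auto
      finally show ?thesis .
    qed
    then have "summable (\<lambda>k. norm (?h k - 1))"
      by (intro summable_comparison_test[OF _ summable_mult[OF geo, of "2 * pi * \<bar>\<xi>\<bar>"]]) auto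
    then have "convergent_prod ?h"
      by (intro abs_convergent_prod_imp_convergent_prod summable_imp_abs_convergent_prod)
    then have hp: "?h has_prod prodinf ?h"
      by (rule convergent_prod_has_prod)
    then have lim1: "(\<lambda>n. \<Prod>k<n. ?h k) \<longlonglongrightarrow> prodinf ?h"
      by (rule has_prod_imp_tendsto')
    have partial: "(\<Prod>k<n. ?h k) = (CLINT \<omega>|P. expo \<xi> (\<Sum>k<n. X k \<omega>))" for n
    proof -
      have "(\<Prod>k<n. ?h k) = (\<Prod>k<n. char (distr P borel (X k)) (- 2 * pi * \<xi>))"
        by (simp only: factor[symmetric] fourier_transform_eq_char)
      also have "\<dots> = char (distr P borel (\<lambda>\<omega>. \<Sum>k<n. X k \<omega>)) (- 2 * pi * \<xi>)"
        using P.indep_vars_subset[OF indep, of "{..<n}"] by (simp add: P.char_distr_sum)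
      also have "\<dots> = (CLINT \<omega>|P. expo \<xi> (\<Sum>k<n. X k \<omega>))"
        unfolding fourier_transform_eq_char[symmetric] fourier_transform_def
        by (rule integral_distr) auto
      finally show ?thesis .
    qed
    have "(\<lambda>n. CLINT \<omega>|P. expo \<xi> (\<Sum>k<n. X k \<omega>)) \<longlonglongrightarrow> (CLINT \<omega>|P. expo \<xi> (S \<omega>))"
    proof (rule integral_dominated_convergence[where w = "\<lambda>_. 1"])
      show "AE \<omega> in P. (\<lambda>n. expo \<xi> (\<Sum>k<n. X k \<omega>)) \<longlonglongrightarrow> expo \<xi> (S \<omega>)"
        unfolding expo_def S_def
        by (intro AE_I2 tendsto_intros summable_LIMSEQ X_summable)
      show "AE \<omega> in P. norm (expo \<xi> (\<Sum>k<n. X k \<omega>)) \<le> 1" for n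
        unfolding expo_eq_iexp by (simp add: norm_exp_eq_Re)
    qed auto
    also have "(CLINT \<omega>|P. expo \<xi> (S \<omega>)) = fourier_transform \<mu> \<xi>"
      unfolding fourier_transform_def \<mu>_def
      by (rule integral_distr[symmetric]) auto
    finally have "prodinf ?h = fourier_transform \<mu> \<xi>"
      using lim1 LIMSEQ_unique unfolding partial by blast
    then show ?thesis using hp by simp
  qed
  have "AE x in \<mu>. x \<in> {0..2}"
    unfolding \<mu>_def using S_bounds by (subst AE_distr_iff) auto
  then have "compactly_supported \<mu>"
    unfolding compactly_supported_def by (intro exI[of _ "{0..2}"]) auto
  then have "is_riesz_product_measure b d \<mu>"
    unfolding is_riesz_product_measure_def
    using prod \<mu>.real_distribution_axioms by (simp add: D_def)
  then show ?thesis by blast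
qed

lemma is_riesz_product_measure_unique:
  assumes "is_riesz_product_measure b d \<mu>" "is_riesz_product_measure b d \<nu>"
  shows "\<mu> = \<nu>"
proof (rule Levy_uniqueness)
  have "fourier_transform \<mu> \<xi> = fourier_transform \<nu> \<xi>" for \<xi>
    using assms unfolding is_riesz_product_measure_def by (blast intro: has_prod_unique2)
  from this[of "- t / (2 * pi)" for t] show "char \<mu> = char \<nu>"
    by (intro ext) (simp add: fourier_transform_eq_char)
qed (use assms in \<open>auto simp: is_riesz_product_measure_def\<close>)

lemma is_riesz_product_measure_riesz_product_measure:
  assumes "\<And>n. n \<ge> 1 \<Longrightarrow> d n \<ge> 1" and "\<And>n. n \<ge> 1 \<Longrightarrow> b n \<ge> 2"
  shows "is_riesz_product_measure b d (riesz_product_measure b d)"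
proof -
  have "\<exists>!\<mu>. is_riesz_product_measure b d \<mu>"
    using riesz_product_measure_exists[of d b, OF assms] is_riesz_product_measure_unique
    by blast
  then show ?thesis
    unfolding riesz_product_measure_def by (rule theI')
qed

end

theory Submission
  imports Defs
begin

text \<open>
  Write \<open>R n = b 1 * ... * b n\<close>, \<open>N n = d 1 * ... * d n\<close> and \<open>q n = b n / d n \<ge> 2\<close>. The \<open>n\<close>th factor
  of the infinite product is the Fourier transform of the uniform distribution on the points
  \<open>a * q n / R n\<close> with \<open>0 \<le> a < d n\<close>. So \<open>\<mu>\<close> is the law of a number with independent random digits
  \<open>a * q n\<close> in the mixed radix system with bases \<open>b n\<close>. Stopping after \<open>n\<close> digits gives the central
  tool of the proof, a self-similarity (\<open>integral_self_similar\<close>): \<open>\<mu>\<close> is the average of \<open>N n\<close> copies of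
  a measure \<open>tail n\<close>, a Riesz product for the shifted sequences and hence carried by \<open>[0, 1)\<close>, each
  scaled by \<open>1 / R n\<close> and placed on a cell \<open>[m / R n, (m + 1) / R n)\<close> with \<open>m\<close> in a set \<open>A n\<close> of integers.

  Spectrality. Let \<open>L n\<close> be the set of integers \<open>R 0 * l 1 + ... + R (n - 1) * l n\<close>, where \<open>l k\<close>
  runs through \<open>d k\<close> consecutive integers centred at \<open>0\<close>. The exponentials with frequencies in
  \<open>\<Lambda> = (\<Union>n. L n)\<close> are orthonormal, since for distinct frequencies some factor of the product vanishes
  at their difference. For completeness consider a function \<open>g\<close> that is constant on the cells of
  level \<open>n\<close>. By self-similarity its coefficient at \<open>\<zeta> \<in> L n\<close> is a finite Fourier coefficient over \<open>A n\<close>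
  times the Fourier transform of \<open>tail n\<close> at \<open>- \<zeta> / R n\<close>. The finite coefficients satisfy Parseval's
  identity. The choice of balanced digits, together with \<open>q k \<ge> 2\<close>, gives \<open>\<bar>\<zeta>\<bar> \<le> R n / 3\<close>; as \<open>tail n\<close> lives on
  an interval of length \<open>1\<close>, the phases then spread over an arc of angle at most \<open>2 * pi / 3\<close> and the
  extra factor has modulus at least \<open>1 / 2\<close>. Hence the squared coefficients of \<open>g\<close> over \<open>L n\<close> add up
  to at least a quarter of its squared norm (\<open>step_frame_bound\<close>). Such step functions are dense in
  \<open>L\<^sup>2(\<mu>)\<close>, and a lower frame bound on a dense set, independent of \<open>n\<close>, forces an orthonormal
  family to be complete (\<open>frame_bound_imp_basis\<close>).

  Dimension. The measure is carried by the points all of whose cells have labels in \<open>A n\<close>; this set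
  is covered by \<open>N n\<close> intervals of length \<open>1 / R n\<close>. Since
  \<open>s * ln (R n) - ln (N n)\<close> is a sum of terms \<open>ln (b k) * (s - ln (d k) / ln (b k))\<close>, it tends to
  infinity for \<open>s > \<alpha>\<close>, which makes the \<open>s\<close>-dimensional measure of the carrier vanish, and it is
  bounded above for \<open>s < \<alpha>\<close>. In the latter case every interval of length \<open>r < 1\<close> has mass at most a
  constant times \<open>r powr s\<close> (\<open>mass_interval_powr\<close>), and the mass distribution principle shows that no
  set of full measure has dimension smaller than \<open>\<alpha>\<close>.
\<close>

section \<open>Exponentials and finite geometric sums\<close>

lemma norm_expo [simp]: "norm (expo \<xi> x) = 1"
  unfolding expo_eq_iexp by (simp add: norm_exp_eq_Re)

lemma expo_add: "expo \<xi> (x + y) = expo \<xi> x * expo \<xi> y"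
  by (simp add: expo_def algebra_simps exp_add[symmetric])

lemma expo_add_freq: "expo (\<xi> + \<eta>) x = expo \<xi> x * expo \<eta> x"
  by (simp add: expo_def algebra_simps exp_add[symmetric])

lemma expo_zero [simp]: "expo \<xi> 0 = 1" "expo 0 x = 1"
  by (simp_all add: expo_def)

lemma cnj_expo: "cnj (expo \<xi> x) = expo (- \<xi>) x"
  by (simp add: expo_def exp_cnj)

lemma expo_divide: "expo \<xi> (x / c) = expo (\<xi> / c) x"
  by (simp add: expo_def mult_ac)

lemma expo_int_mult: "expo (of_int k * of_int j) 1 = 1"
proof -
  have "expo (of_int k * of_int j) 1 = exp (2 * of_real pi * \<i> * of_int (- (k * j)))"
    by (simp add: expo_def mult_ac)
  also have "\<dots> = 1"
    by (subst exp_eq_1) (auto intro!: exI[of _ "- (k * j)"])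
  finally show ?thesis .
qed

lemma expo_int: "expo (of_int k) 1 = 1"
  using expo_int_mult[of k 1] by simp

lemma H_avg_eq_0:
  fixes l :: int
  assumes m: "m \<ge> 1" and l: "\<not> int m dvd l"
  shows "H_avg m (of_int l / of_nat m) = 0"
proof -
  let ?z = "expo 1 (of_int l / of_nat m)"
  have pw: "expo (real j) (of_int l / of_nat m) = ?z ^ j" for j
    by (simp add: expo_def exp_of_nat_mult[symmetric] mult_ac)
  have "?z \<noteq> 1"
  proof
    assume "?z = 1"
    then obtain n :: int where n: "- 2 * pi * (of_int l / of_nat m) = of_int (2 * n) * pi"
      by (auto simp: expo_def exp_eq_1)
    then have "pi * real_of_int l = pi * real_of_int (- n * int m)"
      using m by (simp add: field_simps)
    then have "real_of_int l = real_of_int (- n * int m)"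
      by (simp only: mult_left_cancel pi_neq_zero not_False_eq_True)
    then have "l = - n * int m" by (simp only: of_int_eq_iff)
    then show False using l by simp
  qed
  moreover have "?z ^ m = 1"
  proof -
    have "?z ^ m = expo (of_int l) 1"
      using m unfolding pw[symmetric] by (simp add: expo_def mult_ac)
    then show ?thesis by (simp add: expo_int)
  qed
  ultimately show ?thesis
    unfolding H_avg_def pw by (simp add: geometric_sum)
qed

section \<open>Self-similarity of the Riesz product measure\<close>

text \<open>
  The numerators of the left endpoints of the cells of level \<open>n\<close>, over the common denominator
  \<open>b 1 * ... * b n\<close>. The allowed digits in base \<open>b (n + 1)\<close> are the multiples of
  \<open>b (n + 1) / d (n + 1)\<close>, which keeps distinct cells apart.
\<close>

primrec digit_set :: "(nat \<Rightarrow> nat) \<Rightarrow> (nat \<Rightarrow> nat) \<Rightarrow> nat \<Rightarrow> nat set" where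
  "digit_set b d 0 = {0}"
| "digit_set b d (Suc n) =
     (\<lambda>(m, a). m * b (Suc n) + a * (b (Suc n) div d (Suc n))) ` (digit_set b d n \<times> {..<d (Suc n)})"

declare digit_set.simps(2) [simp del]

locale riesz_sequences =
  fixes b d :: "nat \<Rightarrow> nat"
  assumes d_ge: "n \<ge> 1 \<Longrightarrow> d n \<ge> 2"
    and d_dvd: "n \<ge> 1 \<Longrightarrow> d n dvd b n"
    and b_ge: "n \<ge> 1 \<Longrightarrow> b n \<ge> 2 * d n"
begin

definition R :: "nat \<Rightarrow> nat" where "R n = rho b (Suc n)"
definition N :: "nat \<Rightarrow> nat" where "N n = (\<Prod>k<n. d (Suc k))"
definition q :: "nat \<Rightarrow> nat" where "q n = b n div d n"
abbreviation A :: "nat \<Rightarrow> nat set" where "A \<equiv> digit_set b d"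

text \<open>
  The measure that sits, rescaled, in each cell of level \<open>n\<close>: what remains of \<open>\<mu>\<close> after the first
  \<open>n\<close> digits are fixed and the cell is blown up to unit length.
\<close>

definition tail :: "nat \<Rightarrow> real measure" where
  "tail n = riesz_product_measure (\<lambda>k. b (k + n)) (\<lambda>k. d (k + n))"

abbreviation \<mu> :: "real measure" where "\<mu> \<equiv> riesz_product_measure b d"

lemma R_0 [simp]: "R 0 = 1" and R_Suc: "R (Suc n) = R n * b (Suc n)"
  by (simp_all add: R_def rho_def mult_ac)

lemma N_0 [simp]: "N 0 = 1" and N_Suc: "N (Suc n) = N n * d (Suc n)"
  by (simp_all add: N_def mult_ac)

lemma b_eq: "n \<ge> 1 \<Longrightarrow> b n = q n * d n"
  using d_dvd by (simp add: q_def)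

lemma q_ge: "n \<ge> 1 \<Longrightarrow> q n \<ge> 2"
  using b_ge[of n] d_ge[of n] by (simp add: b_eq)

lemma b_ge4: "n \<ge> 1 \<Longrightarrow> b n \<ge> 4"
  using b_ge[of n] d_ge[of n] by simp

lemma R_pos [simp]: "R n > 0"
proof (induction n)
  case (Suc n)
  then show ?case using b_ge4[of "Suc n"] by (simp add: R_Suc)
qed simp

lemma N_pos [simp]: "N n > 0"
  unfolding N_def using d_ge by (intro prod_pos) (auto intro: less_le_trans[of _ 2])

lemma R_ge: "2 ^ n \<le> R n"
proof (induction n)
  case (Suc n)
  then have "2 ^ n * 2 \<le> R n * b (Suc n)"
    using b_ge4[of "Suc n"] by (intro mult_mono) auto
  then show ?case by (simp add: R_Suc mult_ac)
qed simp

lemma N_ge: "2 ^ n \<le> N n"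
proof (induction n)
  case (Suc n)
  then have "2 ^ n * 2 \<le> N n * d (Suc n)"
    using d_ge[of "Suc n"] by (intro mult_mono) auto
  then show ?case by (simp add: N_Suc mult_ac)
qed simp

lemma filterlim_R: "filterlim (\<lambda>n. real (R n)) at_top sequentially"
proof (rule filterlim_at_top_mono[OF filterlim_real_sequentially])
  have "n \<le> R n" for n
    using R_ge[of n] less_exp[of n] by linarith
  then show "\<forall>\<^sub>F n in sequentially. real n \<le> real (R n)"
    by simp
qed

lemma filterlim_N: "filterlim (\<lambda>n. real (N n)) at_top sequentially"
proof (rule filterlim_at_top_mono[OF filterlim_real_sequentially])
  have "n \<le> N n" for n
    using N_ge[of n] less_exp[of n] by linarith
  then show "\<forall>\<^sub>F n in sequentially. real n \<le> real (N n)"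
    by simp
qed

lemma riesz_sequences_shift: "riesz_sequences (\<lambda>k. b (k + n)) (\<lambda>k. d (k + n))"
  by standard (use d_ge d_dvd b_ge in auto)

lemma is_riesz_\<mu>: "is_riesz_product_measure b d \<mu>"
  by (rule is_riesz_product_measure_riesz_product_measure)
     (use d_ge b_ge4 in \<open>fastforce+\<close>)

lemma is_riesz_tail:
  "is_riesz_product_measure (\<lambda>k. b (k + n)) (\<lambda>k. d (k + n)) (tail n)"
  unfolding tail_def by (rule riesz_sequences.is_riesz_\<mu>[OF riesz_sequences_shift])

lemma real_distribution_\<mu>: "real_distribution \<mu>"
  using is_riesz_\<mu> by (simp add: is_riesz_product_measure_def)

lemma real_distribution_tail: "real_distribution (tail n)"
  using is_riesz_tail by (simp add: is_riesz_product_measure_def)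

text \<open>
  The largest digit is \<open>b n - q n\<close>. The room of \<open>2\<close> that \<open>q n \<ge> 2\<close> leaves is what keeps the support
  strictly to the left of \<open>1\<close>.
\<close>

lemma digit_plus_2_le:
  assumes "n \<ge> 1" "a < d n" shows "a * q n + 2 \<le> b n"
proof -
  have "(a + 1) * q n \<le> d n * q n" using assms by (intro mult_right_mono) auto
  then show ?thesis using q_ge[OF assms(1)] b_eq[OF assms(1)] by (simp add: mult_ac)
qed

lemma A_finite [simp]: "finite (A n)"
  by (induction n) (auto simp: digit_set.simps(2))

lemma A_Suc: "A (Suc n) = (\<lambda>(m, a). m * b (Suc n) + a * q (Suc n)) ` (A n \<times> {..<d (Suc n)})"
  by (simp add: q_def digit_set.simps(2))

lemma inj_A: "inj_on (\<lambda>(m, a). m * b (Suc n) + a * q (Suc n)) (B \<times> {..<d (Suc n)})"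
proof -
  have "m = m' \<and> a = a'"
    if a: "a < d (Suc n)" "a' < d (Suc n)"
      and eq: "m * b (Suc n) + a * q (Suc n) = m' * b (Suc n) + a' * q (Suc n)"
    for m a m' a'
  proof -
    have lt: "a * q (Suc n) < b (Suc n)" "a' * q (Suc n) < b (Suc n)"
      using digit_plus_2_le[of "Suc n" a] digit_plus_2_le[of "Suc n" a'] a by auto
    have "m = (m * b (Suc n) + a * q (Suc n)) div b (Suc n)" using lt by simp
    also have "\<dots> = m'" unfolding eq using lt by simp
    finally show ?thesis using eq q_ge[of "Suc n"] by auto
  qed
  note digits_unique = this
  show ?thesis
    unfolding inj_on_def case_prod_unfold
  proof (intro ballI impI prod_eqI)
    fix x y
    assume "x \<in> B \<times> {..<d (Suc n)}" "y \<in> B \<times> {..<d (Suc n)}"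
      and "fst x * b (Suc n) + snd x * q (Suc n) = fst y * b (Suc n) + snd y * q (Suc n)"
    then show "fst x = fst y" "snd x = snd y"
      using digits_unique[of "snd x" "snd y" "fst x" "fst y"] by auto
  qed
qed

lemma A_sum:
  fixes f :: "nat \<Rightarrow> 'c::comm_monoid_add"
  shows "(\<Sum>m\<in>A (Suc n). f m) = (\<Sum>m\<in>A n. \<Sum>a<d (Suc n). f (m * b (Suc n) + a * q (Suc n)))"
  unfolding A_Suc by (subst sum.reindex[OF inj_A])
    (simp add: sum.cartesian_product case_prod_unfold)

lemma A_card: "card (A n) = N n"
proof (induction n)
  case (Suc n)
  show ?case unfolding A_Suc
    by (subst card_image[OF inj_A]) (simp add: card_cartesian_product Suc N_Suc)
qed simp

lemma A_nonempty: "A n \<noteq> {}"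
  using A_card[of n] N_pos[of n] by (metis card.empty less_irrefl)

lemma A_less: "m \<in> A n \<Longrightarrow> m < R n"
proof (induction n arbitrary: m)
  case (Suc n)
  then obtain m' a where m: "m = m' * b (Suc n) + a * q (Suc n)" "m' \<in> A n" "a < d (Suc n)"
    by (auto simp: A_Suc)
  have "m < (m' + 1) * b (Suc n)" using digit_plus_2_le[of "Suc n" a] m by auto
  also have "\<dots> \<le> R n * b (Suc n)" using Suc.IH[OF m(2)] by (intro mult_right_mono) auto
  finally show ?case by (simp add: R_Suc)
qed simp

lemma A_dvd: "m \<in> A (Suc n) \<Longrightarrow> q (Suc n) dvd m"
  by (auto simp: A_Suc b_eq)

text \<open>
  Multiplying the first \<open>n\<close> factors adds up the digits: the product is the Fourier transform of the
  uniform distribution on the left endpoints of the cells.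
\<close>

lemma prod_H_avg:
  "(\<Prod>k<n. H_avg (d (Suc k)) (\<xi> / (real (d (Suc k)) * real (rho b (Suc k))))) =
   (1 / of_nat (N n)) * (\<Sum>m\<in>A n. expo \<xi> (real m / real (R n)))"
proof (induction n)
  case (Suc n)
  have R': "real (R n) > 0" "real (b (Suc n)) > 0" "real (d (Suc n)) > 0" "real (q (Suc n)) > 0"
    using b_ge4[of "Suc n"] d_ge[of "Suc n"] q_ge[of "Suc n"] by auto
  have "expo \<xi> (real m / real (R n)) * expo (real a) (\<xi> / (real (d (Suc n)) * real (R n)))
     = expo \<xi> (real (m * b (Suc n) + a * q (Suc n)) / real (R (Suc n)))" (is "_ * ?e = expo \<xi> ?x") for m a
  proof -
    have "?e = expo \<xi> (real a / (real (d (Suc n)) * real (R n)))"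
      by (simp add: expo_def mult_ac)
    moreover have "?x = real m / real (R n) + real a / (real (d (Suc n)) * real (R n))"
      using R' by (simp add: R_Suc b_eq[of "Suc n"] field_simps)
    ultimately show ?thesis by (simp add: expo_add)
  qed
  then have "(\<Sum>m\<in>A n. expo \<xi> (real m / real (R n))) * (\<Sum>a<d (Suc n). expo (real a) (\<xi> / (real (d (Suc n)) * real (R n))))
     = (\<Sum>m\<in>A (Suc n). expo \<xi> (real m / real (R (Suc n))))"
    unfolding A_sum by (simp only: sum_product)
  then show ?case
    unfolding prod.lessThan_Suc Suc unfolding R_def[symmetric] H_avg_def N_Suc of_nat_mult
    by (simp add: field_simps)
qed simp

lemma rho_shift: "rho b (Suc (k + n)) = R n * rho (\<lambda>k. b (k + n)) (Suc k)"
  by (induction k) (simp_all add: rho_def R_def prod.atLeastLessThan_Suc mult_ac)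

text \<open>
  Self-similarity on the Fourier side. The factors from index \<open>n\<close> on, evaluated at \<open>\<xi>\<close>, are those of
  the shifted sequences evaluated at \<open>\<xi> / R n\<close>.
\<close>

lemma fourier_\<mu>:
  "fourier_transform \<mu> \<xi> = (1 / of_nat (N n)) * (\<Sum>m\<in>A n. expo \<xi> (real m / real (R n)))
      * fourier_transform (tail n) (\<xi> / real (R n))"
proof -
  let ?h = "\<lambda>k. H_avg (d (Suc k)) (\<xi> / (real (d (Suc k)) * real (rho b (Suc k))))"
  let ?h' = "\<lambda>k. H_avg (d (Suc k + n))
      (\<xi> / real (R n) / (real (d (Suc k + n)) * real (rho (\<lambda>k. b (k + n)) (Suc k))))"
  have hh: "?h (k + n) = ?h' k" for k
    unfolding rho_shift by (simp add: mult_ac)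
  have "(\<lambda>M. \<Prod>k<M. ?h k) \<longlonglongrightarrow> fourier_transform \<mu> \<xi>"
    using is_riesz_\<mu> by (intro has_prod_imp_tendsto') (auto simp: is_riesz_product_measure_def)
  then have "(\<lambda>M. \<Prod>k<M + n. ?h k) \<longlonglongrightarrow> fourier_transform \<mu> \<xi>"
    by (rule LIMSEQ_ignore_initial_segment)
  also have "(\<lambda>M. \<Prod>k<M + n. ?h k) = (\<lambda>M. (\<Prod>k<n. ?h k) * (\<Prod>k<M. ?h' k))"
  proof
    fix M show "(\<Prod>k<M + n. ?h k) = (\<Prod>k<n. ?h k) * (\<Prod>k<M. ?h' k)"
      unfolding hh[symmetric] by (induction M) (simp_all add: mult_ac)
  qed
  finally have 1: "(\<lambda>M. (\<Prod>k<n. ?h k) * (\<Prod>k<M. ?h' k)) \<longlonglongrightarrow> fourier_transform \<mu> \<xi>" .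
  have "(\<lambda>M. \<Prod>k<M. ?h' k) \<longlonglongrightarrow> fourier_transform (tail n) (\<xi> / real (R n))"
    using is_riesz_tail[of n]
    by (intro has_prod_imp_tendsto') (simp add: is_riesz_product_measure_def del: divide_divide_eq_left)
  from LIMSEQ_unique[OF 1 tendsto_mult_left[OF this]] show ?thesis
    unfolding prod_H_avg by simp
qed

text \<open>
  The pair of a uniform random cell \<open>m\<close> and an independent position \<open>x\<close> inside the cell, distributed
  as \<open>tail n\<close>, is mapped to the real line. The resulting law has the Fourier transform of \<open>\<mu>\<close> and
  is therefore equal to \<open>\<mu>\<close>.
\<close>

lemma real_distribution_affine:
  "real_distribution (distr (measure_pmf (pmf_of_set (A n)) \<Otimes>\<^sub>M tail n) borel
     (\<lambda>(m, x). (real m + x) / real (R n)))"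
proof -
  interpret T: real_distribution "tail n" by (rule real_distribution_tail)
  interpret PP: pair_prob_space "measure_pmf (pmf_of_set (A n))" "tail n" ..
  show ?thesis by (rule PP.real_distribution_distr) measurable
qed

lemma integral_affine_pair:
  fixes f :: "real \<Rightarrow> 'c::{banach, second_countable_topology}"
  assumes "integrable (distr (measure_pmf (pmf_of_set (A n)) \<Otimes>\<^sub>M tail n) borel
     (\<lambda>(m, x). (real m + x) / real (R n))) f" (is "integrable ?M f")
  shows "integral\<^sup>L ?M f = (1 / real (N n)) *\<^sub>R (\<Sum>m\<in>A n. LINT x|tail n. f ((real m + x) / real (R n)))"
proof -
  interpret T: real_distribution "tail n" by (rule real_distribution_tail)
  interpret PP: pair_prob_space "measure_pmf (pmf_of_set (A n))" "tail n" ..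
  let ?g = "\<lambda>(m, x). f ((real m + x) / real (R n))"
  have [measurable]: "f \<in> borel_measurable borel" using assms by auto
  have meas: "(\<lambda>(m, x). (real m + x) / real (R n)) \<in>
      measurable (measure_pmf (pmf_of_set (A n)) \<Otimes>\<^sub>M tail n) borel" by measurable
  have int: "integrable (measure_pmf (pmf_of_set (A n)) \<Otimes>\<^sub>M tail n) ?g"
    using assms integrable_distr_eq[OF meas, of f] by (simp add: case_prod_unfold)
  have "integral\<^sup>L ?M f = integral\<^sup>L (measure_pmf (pmf_of_set (A n)) \<Otimes>\<^sub>M tail n) ?g"
    using integral_distr[OF meas, of f] by (simp add: case_prod_unfold)
  also have "\<dots> = (\<integral>m. (LINT x|tail n. ?g (m, x)) \<partial>measure_pmf (pmf_of_set (A n)))"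
    by (rule PP.integral_fst'[OF int, symmetric])
  also have "\<dots> = (\<Sum>m\<in>A n. pmf (pmf_of_set (A n)) m *\<^sub>R (LINT x|tail n. ?g (m, x)))"
    using A_nonempty by (intro integral_measure_pmf) auto
  also have "\<dots> = (1 / real (N n)) *\<^sub>R (\<Sum>m\<in>A n. LINT x|tail n. f ((real m + x) / real (R n)))"
    unfolding scaleR_sum_right using A_nonempty by (intro sum.cong) (auto simp: A_card)
  finally show ?thesis .
qed

lemma \<mu>_eq_distr:
  "\<mu> = distr (measure_pmf (pmf_of_set (A n)) \<Otimes>\<^sub>M tail n) borel
         (\<lambda>(m, x). (real m + x) / real (R n))" (is "_ = ?M")
proof (rule Levy_uniqueness[OF real_distribution_\<mu> real_distribution_affine])
  interpret T: real_distribution "tail n" by (rule real_distribution_tail)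
  interpret M: real_distribution ?M by (rule real_distribution_affine)
  have "fourier_transform ?M \<xi> = fourier_transform \<mu> \<xi>" for \<xi>
  proof -
    have "fourier_transform ?M \<xi> = (1 / real (N n)) *\<^sub>R (\<Sum>m\<in>A n. LINT x|tail n. expo \<xi> ((real m + x) / real (R n)))"
      unfolding fourier_transform_def
      by (intro integral_affine_pair M.integrable_const_bound[where B = 1]) auto
    also have "\<dots> = (1 / real (N n)) *\<^sub>R (\<Sum>m\<in>A n. expo \<xi> (real m / real (R n)) * fourier_transform (tail n) (\<xi> / real (R n)))"
      by (simp add: add_divide_distrib expo_add fourier_transform_def expo_divide)
    also have "\<dots> = fourier_transform \<mu> \<xi>"
      unfolding fourier_\<mu>[of \<xi> n] by (simp add: scaleR_conv_of_real sum_distrib_right)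
    finally show ?thesis .
  qed
  from this[of "- t / (2 * pi)" for t] show "char \<mu> = char ?M"
    by (intro ext) (simp add: fourier_transform_eq_char)
qed

lemma integral_self_similar:
  fixes f :: "real \<Rightarrow> 'c::{banach, second_countable_topology}"
  assumes "integrable \<mu> f"
  shows "integral\<^sup>L \<mu> f = (1 / real (N n)) *\<^sub>R (\<Sum>m\<in>A n. LINT x|tail n. f ((real m + x) / real (R n)))"
  using integral_affine_pair[of n f] assms unfolding \<mu>_eq_distr[of n, symmetric] by simp

lemma prob_self_similar:
  assumes "B \<in> sets borel"
  shows "measure \<mu> B = (1 / real (N n)) * (\<Sum>m\<in>A n. measure (tail n) {x. (real m + x) / real (R n) \<in> B})"
proof -
  interpret M: real_distribution \<mu> by (rule real_distribution_\<mu>)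
  interpret T: real_distribution "tail n" by (rule real_distribution_tail)
  have "integrable \<mu> (\<lambda>x. indicator B x :: real)"
    using assms by (intro M.integrable_const_bound[where B = 1]) (auto simp: indicator_def)
  from integral_self_similar[OF this, of n]
  have "measure \<mu> B = (1 / real (N n)) * (\<Sum>m\<in>A n. LINT x|tail n. indicator B ((real m + x) / real (R n)))"
    by simp
  also have "(\<lambda>m. LINT x|tail n. indicator B ((real m + x) / real (R n)) :: real) =
     (\<lambda>m. LINT x|tail n. indicator {x. (real m + x) / real (R n) \<in> B} x)"
    by (simp add: indicator_def)
  finally show ?thesis by simp
qed

lemma AE_self_similar:
  assumes [measurable]: "Measurable.pred borel P"
    and *: "\<And>m. m \<in> A n \<Longrightarrow> AE x in tail n. P ((real m + x) / real (R n))"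
  shows "AE x in \<mu>. P x"
proof -
  interpret M: real_distribution \<mu> by (rule real_distribution_\<mu>)
  interpret T: real_distribution "tail n" by (rule real_distribution_tail)
  have "measure \<mu> {x. P x} = (1 / real (N n)) * (\<Sum>m\<in>A n. measure (tail n) {x. P ((real m + x) / real (R n))})"
    by (subst prob_self_similar[of _ n]) auto
  also have "(\<Sum>m\<in>A n. measure (tail n) {x. P ((real m + x) / real (R n))}) = (\<Sum>m\<in>A n. 1)"
    using * T.prob_Collect_eq_1[of "\<lambda>x. P ((real m + x) / real (R n))" for m] by (intro sum.cong) auto
  finally have "measure \<mu> {x\<in>space \<mu>. P x} = 1" by (simp add: A_card)
  then show ?thesis by (subst (asm) M.prob_Collect_eq_1) auto
qed

text \<open>
  The defining conditions only provide some compact carrier, which could depend on the sequences in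
  an uncontrolled way. A uniform one comes from Levy's continuity theorem: the uniform distributions
  on the points \<open>m / R n\<close> of \<open>[0, 1]\<close> converge weakly to \<open>\<mu>\<close>, so a nonnegative bounded continuous
  function that vanishes exactly on \<open>[0, 1]\<close> has integral \<open>0\<close>.
\<close>

lemma support_unit: "AE x in \<mu>. 0 \<le> x \<and> x \<le> 1"
proof -
  interpret M: real_distribution \<mu> by (rule real_distribution_\<mu>)
  define \<nu> where "\<nu> n = distr (measure_pmf (pmf_of_set (A n))) borel (\<lambda>m. real m / real (R n))" for n
  define f where "f x = min 1 (max (- x) (max 0 (x - 1)))" for x :: real
  have rd: "real_distribution (\<nu> n)" for n
  proof -
    show ?thesis unfolding \<nu>_def using prob_space.real_distribution_distr[OF prob_space_measure_pmf] by simp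
  qed
  have int\<nu>: "integral\<^sup>L (\<nu> n) g = (1 / real (N n)) *\<^sub>R (\<Sum>m\<in>A n. g (real m / real (R n)))"
    if [measurable]: "g \<in> borel_measurable borel"
    for n and g :: "real \<Rightarrow> 'c::{banach, second_countable_topology}"
  proof -
    have "integral\<^sup>L (\<nu> n) g = (\<integral>m. g (real m / real (R n)) \<partial>measure_pmf (pmf_of_set (A n)))"
      unfolding \<nu>_def by (rule integral_distr) auto
    also have "\<dots> = (\<Sum>m\<in>A n. pmf (pmf_of_set (A n)) m *\<^sub>R g (real m / real (R n)))"
      using A_nonempty by (intro integral_measure_pmf) auto
    also have "\<dots> = (1 / real (N n)) *\<^sub>R (\<Sum>m\<in>A n. g (real m / real (R n)))"
      unfolding scaleR_sum_right using A_nonempty by (intro sum.cong) (auto simp: A_card)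
    finally show ?thesis .
  qed
  have ft: "(\<lambda>n. fourier_transform (\<nu> n) \<xi>) \<longlonglongrightarrow> fourier_transform \<mu> \<xi>" for \<xi>
  proof -
    have "(\<lambda>M. \<Prod>k<M. H_avg (d (Suc k)) (\<xi> / (real (d (Suc k)) * real (rho b (Suc k)))))
        \<longlonglongrightarrow> fourier_transform \<mu> \<xi>"
      using is_riesz_\<mu> by (intro has_prod_imp_tendsto') (auto simp: is_riesz_product_measure_def)
    then show ?thesis
      unfolding prod_H_avg fourier_transform_def[of "\<nu> _"]
      by (simp add: int\<nu> scaleR_conv_of_real)
  qed
  have "weak_conv_m \<nu> \<mu>"
    using ft[of "- t / (2 * pi)" for t]
    by (intro levy_continuity rd real_distribution_\<mu>) (simp add: fourier_transform_eq_char)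
  then have "(\<lambda>n. integral\<^sup>L (\<nu> n) f) \<longlonglongrightarrow> integral\<^sup>L \<mu> f"
    by (rule weak_conv_imp_integral_bdd_continuous_conv[OF rd real_distribution_\<mu>, where B = 1])
       (auto simp: f_def[abs_def] intro!: continuous_intros)
  moreover have "integral\<^sup>L (\<nu> n) f = 0" for n
  proof -
    have "f \<in> borel_measurable borel" unfolding f_def by measurable
    then have "integral\<^sup>L (\<nu> n) f = (1 / real (N n)) *\<^sub>R (\<Sum>m\<in>A n. f (real m / real (R n)))"
      by (rule int\<nu>)
    also have "(\<Sum>m\<in>A n. f (real m / real (R n))) = 0"
    proof (intro sum.neutral ballI)
      fix m assume "m \<in> A n"
      then have "real m / real (R n) \<le> 1" using A_less[of m n] by simp
      then show "f (real m / real (R n)) = 0" by (simp add: f_def)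
    qed
    finally show ?thesis by simp
  qed
  ultimately have "integral\<^sup>L \<mu> f = 0"
    using LIMSEQ_unique[of "\<lambda>_. 0 :: real"] by auto
  moreover have "integrable \<mu> f"
    by (intro M.integrable_const_bound[where B = 1]) (auto simp: f_def[abs_def])
  ultimately have "AE x in \<mu>. f x = 0"
    by (subst (asm) integral_nonneg_eq_0_iff_AE) (auto simp: f_def)
  then show ?thesis
    by eventually_elim (auto simp: f_def min_def max_def split: if_splits)
qed

lemma tail_support_unit: "AE x in tail n. 0 \<le> x \<and> x \<le> 1"
  unfolding tail_def by (rule riesz_sequences.support_unit[OF riesz_sequences_shift])

text \<open>
  The right endpoint has to be excluded to make \<open>\<lfloor>m + x\<rfloor> = m\<close> inside a cell. One application of
  self-similarity is enough: the first digit is at most \<open>b 1 - 2\<close>, so the support lies in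
  \<open>[0, 1 - 1 / b 1]\<close>.
\<close>

lemma support: "AE x in \<mu>. 0 \<le> x \<and> x < 1"
proof (rule AE_self_similar[of _ 1])
  fix m assume "m \<in> A 1"
  moreover have "A 1 = (\<lambda>a. a * q 1) ` {..<d 1}"
    using A_Suc[of 0] by (force simp: image_iff)
  ultimately obtain a where a: "m = a * q 1" "a < d 1" by blast
  then have "m + 2 \<le> b 1" using digit_plus_2_le[of 1 a] by simp
  then have m: "real m + 2 \<le> real (b 1)" by linarith
  have R1: "R (Suc 0) = b (Suc 0)" using R_Suc[of 0] by simp
  show "AE x in tail 1. 0 \<le> (real m + x) / real (R 1) \<and> (real m + x) / real (R 1) < 1"
    using tail_support_unit[of 1] by eventually_elim (use m in \<open>auto simp: R1\<close>)
qed measurable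

lemma tail_support: "AE x in tail n. 0 \<le> x \<and> x < 1"
  unfolding tail_def by (rule riesz_sequences.support[OF riesz_sequences_shift])

end

section \<open>Complete orthonormal families from a frame bound on a dense set\<close>

definition L2_sq :: "real measure \<Rightarrow> (real \<Rightarrow> complex) \<Rightarrow> real" where
  "L2_sq M f = (LINT x|M. (cmod (f x))\<^sup>2)"

lemma cmod_add_sq_le: "(cmod (a + b))\<^sup>2 \<le> 2 * (cmod a)\<^sup>2 + 2 * (cmod b)\<^sup>2"
proof -
  have "(cmod (a + b))\<^sup>2 \<le> (cmod a + cmod b)\<^sup>2"
    by (intro power_mono norm_triangle_ineq) auto
  also have "\<dots> \<le> 2 * (cmod a)\<^sup>2 + 2 * (cmod b)\<^sup>2"
    using sum_squares_bound[of "cmod a" "cmod b"] by (simp add: power2_sum)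
  finally show ?thesis .
qed

lemma square_integrable_measurable: "square_integrable M f \<Longrightarrow> f \<in> borel_measurable M"
  and square_integrable_integrable: "square_integrable M f \<Longrightarrow> integrable M (\<lambda>x. (cmod (f x))\<^sup>2)"
  by (auto simp: square_integrable_def)

lemma square_integrable_add:
  assumes "square_integrable M f" "square_integrable M g"
  shows "square_integrable M (\<lambda>x. f x + g x)"
proof -
  note [measurable] = assms[THEN square_integrable_measurable]
  have "integrable M (\<lambda>x. (cmod (f x + g x))\<^sup>2)"
    by (rule Bochner_Integration.integrable_bound[of M "\<lambda>x. 2 * (cmod (f x))\<^sup>2 + 2 * (cmod (g x))\<^sup>2"])
       (use assms in \<open>auto simp: cmod_add_sq_le intro!: square_integrable_integrable\<close>)
  then show ?thesis by (simp add: square_integrable_def)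
qed

lemma square_integrable_scale:
  assumes "square_integrable M f" shows "square_integrable M (\<lambda>x. c * f x)"
  using assms by (auto simp: square_integrable_def norm_mult power_mult_distrib)

lemma square_integrable_diff:
  assumes "square_integrable M f" "square_integrable M g"
  shows "square_integrable M (\<lambda>x. f x - g x)"
  using square_integrable_add[OF assms(1) square_integrable_scale[OF assms(2), of "-1"]] by simp

lemma square_integrable_sum:
  assumes "\<And>i. i \<in> F \<Longrightarrow> square_integrable M (f i)"
  shows "square_integrable M (\<lambda>x. \<Sum>i\<in>F. f i x)"
  using assms
proof (induction F rule: infinite_finite_induct)
  case (insert i F)
  then show ?case by (simp add: square_integrable_add)
qed (auto simp: square_integrable_def)

lemma L2_sq_nonneg: "L2_sq M f \<ge> 0"
  by (simp add: L2_sq_def)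

lemma L2_sq_add_le:
  assumes "square_integrable M f" "square_integrable M g"
  shows "L2_sq M (\<lambda>x. f x + g x) \<le> 2 * L2_sq M f + 2 * L2_sq M g"
proof -
  have "L2_sq M (\<lambda>x. f x + g x) \<le> (LINT x|M. 2 * (cmod (f x))\<^sup>2 + 2 * (cmod (g x))\<^sup>2)"
    unfolding L2_sq_def using assms square_integrable_add[OF assms]
    by (intro integral_mono) (auto intro!: square_integrable_integrable cmod_add_sq_le)
  also have "\<dots> = 2 * L2_sq M f + 2 * L2_sq M g"
    unfolding L2_sq_def using assms[THEN square_integrable_integrable] by simp
  finally show ?thesis .
qed

lemma L2_sq_scale: "L2_sq M (\<lambda>x. c * f x) = (cmod c)\<^sup>2 * L2_sq M f"
  by (simp add: L2_sq_def norm_mult power_mult_distrib)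

lemma L2_inner_integrable:
  assumes "square_integrable M f" "square_integrable M g"
  shows "integrable M (\<lambda>x. f x * cnj (g x))"
proof -
  note [measurable] = assms[THEN square_integrable_measurable]
  have cnj: "(\<lambda>x. cnj (g x)) \<in> borel_measurable M"
    by (rule measurable_compose[OF square_integrable_measurable[OF assms(2)]])
       (intro borel_measurable_continuous_onI continuous_intros)
  have *: "cmod (f x) * cmod (g x) \<le> (cmod (f x))\<^sup>2 + (cmod (g x))\<^sup>2" for x
    using sum_squares_bound[of "cmod (f x)" "cmod (g x)"]
      mult_nonneg_nonneg[OF norm_ge_zero[of "f x"] norm_ge_zero[of "g x"]] by linarith
  show ?thesis
    by (rule Bochner_Integration.integrable_bound[of M "\<lambda>x. (cmod (f x))\<^sup>2 + (cmod (g x))\<^sup>2"])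
       (use assms cnj in \<open>auto simp: * norm_mult intro!: square_integrable_integrable borel_measurable_times\<close>)
qed

lemma L2_inner_add:
  assumes "square_integrable M f" "square_integrable M g" "square_integrable M h"
  shows "L2_inner M (\<lambda>x. f x + g x) h = L2_inner M f h + L2_inner M g h"
  unfolding L2_inner_def using assms L2_inner_integrable
  by (subst Bochner_Integration.integral_add[symmetric]) (auto simp: distrib_right)

lemma L2_inner_scale: "L2_inner M (\<lambda>x. c * f x) h = c * L2_inner M f h"
  by (simp add: L2_inner_def mult.assoc)

lemma L2_inner_diff:
  assumes "square_integrable M f" "square_integrable M g" "square_integrable M h"
  shows "L2_inner M (\<lambda>x. f x - g x) h = L2_inner M f h - L2_inner M g h"
  using L2_inner_add[OF assms(1) square_integrable_scale[OF assms(2), of "-1"] assms(3)]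
    L2_inner_scale[of M "-1" g h] by simp

lemma L2_inner_sum:
  assumes "\<And>i. i \<in> F \<Longrightarrow> square_integrable M (f i)" "square_integrable M h"
  shows "L2_inner M (\<lambda>x. \<Sum>i\<in>F. f i x) h = (\<Sum>i\<in>F. L2_inner M (f i) h)"
  using assms
proof (induction F rule: infinite_finite_induct)
  case (insert i F)
  then show ?case by (simp add: L2_inner_add square_integrable_sum)
qed (auto simp: L2_inner_def)

lemma L2_sq_diff_scale:
  assumes "square_integrable M f" "square_integrable M g"
  shows "L2_sq M (\<lambda>x. f x - c * g x) =
    L2_sq M f - 2 * Re (cnj c * L2_inner M f g) + (cmod c)\<^sup>2 * L2_sq M g"
proof -
  have "(cmod (f x - c * g x))\<^sup>2 =
      (cmod (f x))\<^sup>2 - 2 * Re (cnj c * (f x * cnj (g x))) + (cmod c)\<^sup>2 * (cmod (g x))\<^sup>2" for x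
    unfolding cmod_power2 by (simp add: power2_eq_square algebra_simps)
  then have "L2_sq M (\<lambda>x. f x - c * g x) = (LINT x|M. (cmod (f x))\<^sup>2
      - 2 * Re (cnj c * (f x * cnj (g x))) + (cmod c)\<^sup>2 * (cmod (g x))\<^sup>2)"
    unfolding L2_sq_def by simp
  also have "\<dots> = (LINT x|M. (cmod (f x))\<^sup>2) - 2 * (LINT x|M. Re (cnj c * (f x * cnj (g x))))
      + (cmod c)\<^sup>2 * (LINT x|M. (cmod (g x))\<^sup>2)"
  proof -
    have f2: "integrable M (\<lambda>x. (cmod (f x))\<^sup>2)"
      and g2: "integrable M (\<lambda>x. (cmod c)\<^sup>2 * (cmod (g x))\<^sup>2)"
      and fg: "integrable M (\<lambda>x. 2 * Re (cnj c * (f x * cnj (g x))))"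
      by (rule square_integrable_integrable integrable_mult_right assms integrable_Re
          L2_inner_integrable)+
    show ?thesis
      by (simp only: Bochner_Integration.integral_diff[OF f2 fg] integral_mult_right_zero
          Bochner_Integration.integral_add[OF Bochner_Integration.integrable_diff[OF f2 fg] g2])
  qed
  also have "(LINT x|M. Re (cnj c * (f x * cnj (g x)))) = Re (cnj c * L2_inner M f g)"
    unfolding L2_inner_def integral_mult_right_zero[symmetric]
    by (rule integral_Re integrable_mult_right L2_inner_integrable assms)+
  also note L2_sq_def[symmetric, of M f]
  also note L2_sq_def[symmetric, of M g]
  finally show ?thesis .
qed

definition orthonormal :: "real measure \<Rightarrow> 'i set \<Rightarrow> ('i \<Rightarrow> real \<Rightarrow> complex) \<Rightarrow> bool" where
  "orthonormal M \<Lambda> e \<longleftrightarrow> (\<forall>i\<in>\<Lambda>. square_integrable M (e i)) \<and>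
     (\<forall>i\<in>\<Lambda>. \<forall>j\<in>\<Lambda>. L2_inner M (e i) (e j) = (if i = j then 1 else 0))"

lemma L2_sq_eq_inner: "L2_sq M f = Re (L2_inner M f f)"
proof -
  have "(\<lambda>x. f x * cnj (f x)) = (\<lambda>x. complex_of_real ((cmod (f x))\<^sup>2))"
    by (intro ext) (simp only: complex_norm_square)
  then show ?thesis
    unfolding L2_sq_def L2_inner_def by (simp only: integral_complex_of_real Re_complex_of_real)
qed

text \<open>
  Removing the coefficients one at a time is harmless, because by orthogonality the residual still
  has the original coefficient at every index not yet treated.
\<close>

lemma L2_sq_projection:
  assumes on: "orthonormal M \<Lambda> e" and h: "square_integrable M h"
    and F: "finite F" "F \<subseteq> \<Lambda>"
  shows "L2_sq M (\<lambda>x. h x - (\<Sum>i\<in>F. L2_inner M h (e i) * e i x)) =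
    L2_sq M h - (\<Sum>i\<in>F. (cmod (L2_inner M h (e i)))\<^sup>2)"
  using F
proof (induction F rule: finite_induct)
  case (insert j F)
  let ?a = "\<lambda>i. L2_inner M h (e i)"
  let ?p = "\<lambda>x. \<Sum>i\<in>F. ?a i * e i x"
  have e: "square_integrable M (e i)" if "i \<in> \<Lambda>" for i
    using on that by (auto simp: orthonormal_def)
  have p: "square_integrable M ?p"
    using insert by (intro square_integrable_sum square_integrable_scale e) auto
  have "L2_inner M ?p (e j) = (\<Sum>i\<in>F. ?a i * L2_inner M (e i) (e j))"
    using insert by (subst L2_inner_sum)
      (auto simp: L2_inner_scale intro!: e square_integrable_scale)
  also have "\<dots> = 0"
  proof (intro sum.neutral ballI)
    fix i assume "i \<in> F"
    then have "i \<in> \<Lambda>" "j \<in> \<Lambda>" "i \<noteq> j" using insert by auto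
    then show "?a i * L2_inner M (e i) (e j) = 0" using on by (simp add: orthonormal_def)
  qed
  finally have ip: "L2_inner M (\<lambda>x. h x - ?p x) (e j) = ?a j"
    using insert by (subst L2_inner_diff[OF h p]) (auto intro: e)
  have ej: "L2_sq M (e j) = 1"
    using insert on by (simp add: L2_sq_eq_inner orthonormal_def)
  have "L2_sq M (\<lambda>x. (h x - ?p x) - ?a j * e j x) =
      L2_sq M (\<lambda>x. h x - ?p x) - 2 * Re (cnj (?a j) * ?a j) + (cmod (?a j))\<^sup>2"
    using insert by (subst L2_sq_diff_scale[OF square_integrable_diff[OF h p]]) (auto simp: ip ej e)
  also have "Re (cnj (?a j) * ?a j) = (cmod (?a j))\<^sup>2"
    unfolding cmod_power2 by (simp add: power2_eq_square)
  finally show ?case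
    using insert by (simp add: algebra_simps)
qed simp

lemma bessel_inequality:
  assumes "orthonormal M \<Lambda> e" "square_integrable M h" "finite F" "F \<subseteq> \<Lambda>"
  shows "(\<Sum>i\<in>F. (cmod (L2_inner M h (e i)))\<^sup>2) \<le> L2_sq M h"
  using L2_sq_projection[OF assms] L2_sq_nonneg[of M "\<lambda>x. h x - (\<Sum>i\<in>F. L2_inner M h (e i) * e i x)"]
  by simp

definition L2_dense :: "real measure \<Rightarrow> (real \<Rightarrow> complex) set \<Rightarrow> bool" where
  "L2_dense M C \<longleftrightarrow> (\<forall>g\<in>C. square_integrable M g) \<and>
     (\<forall>f. square_integrable M f \<longrightarrow> (\<forall>\<epsilon>>0. \<exists>g\<in>C. L2_sq M (\<lambda>x. f x - g x) < \<epsilon>))"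

text \<open>
  By Bessel's inequality the coefficients of \<open>h\<close> and of a close \<open>g \<in> C\<close> differ in the \<open>l\<^sup>2\<close> norm by at
  most the distance of \<open>h\<close> and \<open>g\<close>, so the frame bound passes from \<open>g\<close> to \<open>h\<close> at the cost of a factor
  in the constant.
\<close>

lemma frame_bound_extends:
  assumes on: "orthonormal M \<Lambda> e" and C: "L2_dense M C"
    and c: "0 < c" "c \<le> 1"
    and frame: "\<And>g. g \<in> C \<Longrightarrow> \<exists>F. finite F \<and> F \<subseteq> \<Lambda> \<and>
        c * L2_sq M g \<le> (\<Sum>i\<in>F. (cmod (L2_inner M g (e i)))\<^sup>2)"
    and h: "square_integrable M h"
  shows "\<exists>F. finite F \<and> F \<subseteq> \<Lambda> \<and> c / 8 * L2_sq M h \<le> (\<Sum>i\<in>F. (cmod (L2_inner M h (e i)))\<^sup>2)"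
proof (cases "L2_sq M h = 0")
  case True
  then show ?thesis by (intro exI[of _ "{}"]) auto
next
  case False
  then have pos: "L2_sq M h > 0" using L2_sq_nonneg[of M h] by simp
  \<comment> \<open>With relative error \<open>c / 16\<close> the estimates below give the constant \<open>5 * c / 32\<close>, which exceeds \<open>c / 8\<close>.\<close>
  then obtain g where g: "g \<in> C" and close: "L2_sq M (\<lambda>x. h x - g x) < c / 16 * L2_sq M h"
    using C h c unfolding L2_dense_def by (metis divide_pos_pos mult_pos_pos zero_less_numeral)
  have gsq: "square_integrable M g" using C g by (auto simp: L2_dense_def)
  let ?r = "\<lambda>x. h x - g x"
  have rsq: "square_integrable M ?r" by (rule square_integrable_diff[OF h gsq])
  obtain F where F: "finite F" "F \<subseteq> \<Lambda>"
    and frF: "c * L2_sq M g \<le> (\<Sum>i\<in>F. (cmod (L2_inner M g (e i)))\<^sup>2)"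
    using frame[OF g] by blast
  have "(\<Sum>i\<in>F. (cmod (L2_inner M g (e i)))\<^sup>2) \<le>
      (\<Sum>i\<in>F. 2 * (cmod (L2_inner M h (e i)))\<^sup>2 + 2 * (cmod (L2_inner M ?r (e i)))\<^sup>2)"
  proof (rule sum_mono)
    fix i assume "i \<in> F"
    then have "square_integrable M (e i)" using F on by (auto simp: orthonormal_def)
    then have "L2_inner M g (e i) = L2_inner M h (e i) + (- L2_inner M ?r (e i))"
      by (simp add: L2_inner_diff[OF h gsq])
    then show "(cmod (L2_inner M g (e i)))\<^sup>2 \<le>
        2 * (cmod (L2_inner M h (e i)))\<^sup>2 + 2 * (cmod (L2_inner M ?r (e i)))\<^sup>2"
      using cmod_add_sq_le[of "L2_inner M h (e i)" "- L2_inner M ?r (e i)"] by simp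
  qed
  also have "\<dots> = 2 * (\<Sum>i\<in>F. (cmod (L2_inner M h (e i)))\<^sup>2) + 2 * (\<Sum>i\<in>F. (cmod (L2_inner M ?r (e i)))\<^sup>2)"
    by (simp add: sum.distrib sum_distrib_left)
  also have "\<dots> \<le> 2 * (\<Sum>i\<in>F. (cmod (L2_inner M h (e i)))\<^sup>2) + 2 * L2_sq M ?r"
    using bessel_inequality[OF on rsq F] by simp
  finally have 1: "c * L2_sq M g \<le> 2 * (\<Sum>i\<in>F. (cmod (L2_inner M h (e i)))\<^sup>2) + 2 * L2_sq M ?r"
    using frF by linarith
  have "L2_sq M h \<le> 2 * L2_sq M g + 2 * L2_sq M ?r"
    using L2_sq_add_le[OF gsq rsq] by simp
  then have "L2_sq M g \<ge> L2_sq M h / 2 - L2_sq M ?r" by simp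
  then have "c * L2_sq M g \<ge> c * (L2_sq M h / 2 - L2_sq M ?r)"
    using c by (intro mult_left_mono) auto
  then have "c * L2_sq M g \<ge> c * L2_sq M h / 2 - L2_sq M ?r"
    using c mult_right_mono[of c 1 "L2_sq M ?r"] L2_sq_nonneg[of M ?r] by (simp add: algebra_simps)
  then have "c / 8 * L2_sq M h \<le> (\<Sum>i\<in>F. (cmod (L2_inner M h (e i)))\<^sup>2)"
    using 1 close mult_pos_pos[OF c(1) pos] by linarith
  then show ?thesis using F by blast
qed

text \<open>
  Subtracting from \<open>h\<close> its projection onto finitely many well-chosen members of the family shrinks
  the squared norm by the fixed factor \<open>1 - c / 8\<close>. Iterating makes the residual arbitrarily small.
\<close>

lemma frame_bound_imp_basis:
  assumes on: "orthonormal M \<Lambda> e" and C: "L2_dense M C"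
    and c: "0 < c" "c \<le> 1"
    and frame: "\<And>g. g \<in> C \<Longrightarrow> \<exists>F. finite F \<and> F \<subseteq> \<Lambda> \<and>
        c * L2_sq M g \<le> (\<Sum>i\<in>F. (cmod (L2_inner M g (e i)))\<^sup>2)"
  shows "L2_orthonormal_basis M \<Lambda> e"
  unfolding L2_orthonormal_basis_def
proof (intro conjI allI impI)
  fix f and \<epsilon> :: real assume f: "square_integrable M f" and \<epsilon>: "\<epsilon> > 0"
  have e: "square_integrable M (e i)" if "i \<in> \<Lambda>" for i
    using on that by (auto simp: orthonormal_def)
  have "\<exists>F a. finite F \<and> F \<subseteq> \<Lambda> \<and>
      L2_sq M (\<lambda>x. f x - (\<Sum>i\<in>F. a i * e i x)) \<le> (1 - c / 8) ^ k * L2_sq M f" for k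
  proof (induction k)
    case 0
    show ?case by (intro exI[of _ "{}"]) auto
  next
    case (Suc k)
    then obtain F a where F: "finite F" "F \<subseteq> \<Lambda>"
      and le: "L2_sq M (\<lambda>x. f x - (\<Sum>i\<in>F. a i * e i x)) \<le> (1 - c / 8) ^ k * L2_sq M f"
      by blast
    define h where "h x = f x - (\<Sum>i\<in>F. a i * e i x)" for x
    have h: "square_integrable M h"
      unfolding h_def using F
      by (intro square_integrable_diff f square_integrable_sum square_integrable_scale e) auto
    obtain G where G: "finite G" "G \<subseteq> \<Lambda>"
      and ge: "c / 8 * L2_sq M h \<le> (\<Sum>i\<in>G. (cmod (L2_inner M h (e i)))\<^sup>2)"
      using frame_bound_extends[OF on C c frame h] by blast
    define a' where "a' i = (if i \<in> F then a i else 0) + (if i \<in> G then L2_inner M h (e i) else 0)" for i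
    have "(\<Sum>i\<in>F \<union> G. a' i * e i x) = (\<Sum>i\<in>F. a i * e i x) + (\<Sum>i\<in>G. L2_inner M h (e i) * e i x)" for x
      unfolding a'_def using F G
      by (simp add: distrib_right sum.distrib if_distrib[of "\<lambda>u. u * _"] sum.If_cases
          Int_absorb1 cong: if_cong)
    then have eq: "(\<lambda>x. f x - (\<Sum>i\<in>F \<union> G. a' i * e i x)) =
        (\<lambda>x. h x - (\<Sum>i\<in>G. L2_inner M h (e i) * e i x))"
      by (simp add: h_def diff_diff_eq)
    have "L2_sq M (\<lambda>x. f x - (\<Sum>i\<in>F \<union> G. a' i * e i x)) \<le> (1 - c / 8) * L2_sq M h"
      unfolding eq L2_sq_projection[OF on h G] using ge by (simp add: algebra_simps)
    also have "\<dots> \<le> (1 - c / 8) * ((1 - c / 8) ^ k * L2_sq M f)"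
      using le c unfolding h_def by (intro mult_left_mono) auto
    finally show ?case
      using F G by (intro exI[of _ "F \<union> G"] exI[of _ a']) (auto simp: mult_ac)
  qed
  moreover obtain k where "(1 - c / 8) ^ k * L2_sq M f < \<epsilon>"
  proof -
    have "(\<lambda>k. (1 - c / 8) ^ k * L2_sq M f) \<longlonglongrightarrow> 0 * L2_sq M f"
      using c by (intro tendsto_mult LIMSEQ_power_zero tendsto_const) auto
    then have "\<forall>\<^sub>F k in sequentially. (1 - c / 8) ^ k * L2_sq M f < \<epsilon>"
      using \<epsilon> by (intro order_tendstoD) auto
    then show ?thesis using that by (auto simp: eventually_sequentially)
  qed
  ultimately show "\<exists>F c. finite F \<and> F \<subseteq> \<Lambda> \<and> (LINT x|M. (cmod (f x - (\<Sum>i\<in>F. c i * e i x)))\<^sup>2) < \<epsilon>"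
    unfolding L2_sq_def by (meson le_less_trans)
qed (use on in \<open>auto simp: orthonormal_def\<close>)

lemma L2_sq_tendsto_0:
  assumes f: "square_integrable M f" and F: "\<And>i. F i \<in> borel_measurable M"
    and lim: "\<And>x. x \<in> space M \<Longrightarrow> (\<lambda>i. F i x) \<longlonglongrightarrow> f x"
    and bnd: "\<And>i x. x \<in> space M \<Longrightarrow> cmod (F i x) \<le> 2 * cmod (f x)"
  shows "(\<lambda>i. L2_sq M (\<lambda>x. f x - F i x)) \<longlonglongrightarrow> 0"
proof -
  note [measurable] = square_integrable_measurable[OF f] F
  have "(\<lambda>i. L2_sq M (\<lambda>x. f x - F i x)) \<longlonglongrightarrow> (LINT x|M. 0)"
    unfolding L2_sq_def
  proof (rule integral_dominated_convergence[where w = "\<lambda>x. 9 * (cmod (f x))\<^sup>2"])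
    show "integrable M (\<lambda>x. 9 * (cmod (f x))\<^sup>2)"
      using square_integrable_integrable[OF f] by simp
    show "AE x in M. (\<lambda>i. (cmod (f x - F i x))\<^sup>2) \<longlonglongrightarrow> 0"
    proof (rule AE_I2)
      fix x assume "x \<in> space M"
      then have "(\<lambda>i. (cmod (f x - F i x))\<^sup>2) \<longlonglongrightarrow> (cmod (f x - f x))\<^sup>2"
        by (intro tendsto_intros lim)
      then show "(\<lambda>i. (cmod (f x - F i x))\<^sup>2) \<longlonglongrightarrow> 0" by simp
    qed
    show "AE x in M. norm ((cmod (f x - F i x))\<^sup>2) \<le> 9 * (cmod (f x))\<^sup>2" for i
    proof (rule AE_I2)
      fix x assume "x \<in> space M"
      then have "cmod (f x - F i x) \<le> 3 * cmod (f x)"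
        using norm_triangle_ineq4[of "f x" "F i x"] bnd[of x i] by simp
      then have "(cmod (f x - F i x))\<^sup>2 \<le> (3 * cmod (f x))\<^sup>2" by (intro power_mono) auto
      then show "norm ((cmod (f x - F i x))\<^sup>2) \<le> 9 * (cmod (f x))\<^sup>2" by (simp add: power_mult_distrib)
    qed
  qed measurable
  then show ?thesis by simp
qed

definition L2_closure :: "real measure \<Rightarrow> (real \<Rightarrow> complex) set \<Rightarrow> (real \<Rightarrow> complex) set" where
  "L2_closure M C = {f. square_integrable M f \<and> (\<forall>\<epsilon>>0. \<exists>g\<in>C. L2_sq M (\<lambda>x. f x - g x) < \<epsilon>)}"

text \<open>
  The closure of a linear space is closed under dominated pointwise limits. Starting with half-lines,
  it therefore contains the indicators of all Borel sets (by a Dynkin argument), then the simple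
  functions, then everything.
\<close>

lemma L2_dense_if_half_lines:
  assumes "real_distribution M"
    and C_sq: "\<And>g. g \<in> C \<Longrightarrow> square_integrable M g"
    and C_add: "\<And>f g. f \<in> C \<Longrightarrow> g \<in> C \<Longrightarrow> (\<lambda>x. f x + g x) \<in> C"
    and C_scale: "\<And>f c. f \<in> C \<Longrightarrow> (\<lambda>x. c * f x) \<in> C"
    and C_one: "(\<lambda>_. 1) \<in> C"
    and C_Iic: "\<And>a. indicator {..a} \<in> L2_closure M C"
  shows "L2_dense M C"
proof -
  interpret real_distribution M by fact
  let ?K = "L2_closure M C"
  have K_sq: "square_integrable M f" if "f \<in> ?K" for f using that by (simp add: L2_closure_def)
  have K_C: "f \<in> ?K" if "f \<in> C" for f
    using that C_sq by (auto simp: L2_closure_def L2_sq_def intro!: bexI[of _ f])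
  have K_add: "(\<lambda>x. f x + g x) \<in> ?K" if f: "f \<in> ?K" and g: "g \<in> ?K" for f g
    unfolding L2_closure_def
  proof (intro CollectI conjI allI impI)
    show "square_integrable M (\<lambda>x. f x + g x)" using K_sq f g by (intro square_integrable_add)
    fix \<epsilon> :: real assume "\<epsilon> > 0"
    then have "\<epsilon> / 4 > 0" by simp
    then obtain f' g' where f': "f' \<in> C" "L2_sq M (\<lambda>x. f x - f' x) < \<epsilon> / 4"
      and g': "g' \<in> C" "L2_sq M (\<lambda>x. g x - g' x) < \<epsilon> / 4"
      using f g unfolding L2_closure_def by blast
    have "L2_sq M (\<lambda>x. (f x - f' x) + (g x - g' x)) < \<epsilon>"
      using L2_sq_add_le[OF square_integrable_diff[OF K_sq[OF f] C_sq[OF f'(1)]]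
          square_integrable_diff[OF K_sq[OF g] C_sq[OF g'(1)]]] f' g' by simp
    then show "\<exists>h\<in>C. L2_sq M (\<lambda>x. f x + g x - h x) < \<epsilon>"
      using C_add[OF f'(1) g'(1)] by (intro bexI[of _ "\<lambda>x. f' x + g' x"]) (auto simp: algebra_simps)
  qed
  have K_scale: "(\<lambda>x. c * f x) \<in> ?K" if f: "f \<in> ?K" for f c
    unfolding L2_closure_def
  proof (intro CollectI conjI allI impI)
    show "square_integrable M (\<lambda>x. c * f x)" using K_sq f by (intro square_integrable_scale)
    fix \<epsilon> :: real assume \<epsilon>: "\<epsilon> > 0"
    then have "\<epsilon> / ((cmod c)\<^sup>2 + 1) > 0" by (simp add: add_nonneg_pos)
    then obtain f' where f': "f' \<in> C" "L2_sq M (\<lambda>x. f x - f' x) < \<epsilon> / ((cmod c)\<^sup>2 + 1)"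
      using f unfolding L2_closure_def by blast
    have pos: "(cmod c)\<^sup>2 + 1 > 0" by (simp add: add_nonneg_pos)
    have "L2_sq M (\<lambda>x. c * f x - c * f' x) = (cmod c)\<^sup>2 * L2_sq M (\<lambda>x. f x - f' x)"
      by (simp only: L2_sq_scale right_diff_distrib[symmetric])
    also have "\<dots> \<le> ((cmod c)\<^sup>2 + 1) * L2_sq M (\<lambda>x. f x - f' x)"
      by (intro mult_right_mono L2_sq_nonneg) auto
    also have "\<dots> < \<epsilon>"
      using f'(2) pos by (simp add: pos_less_divide_eq mult.commute)
    finally show "\<exists>h\<in>C. L2_sq M (\<lambda>x. c * f x - h x) < \<epsilon>"
      using C_scale[OF f'(1)] by (intro bexI[of _ "\<lambda>x. c * f' x"]) auto
  qed
  have K_limit: "f \<in> ?K" if f: "square_integrable M f" and F: "\<And>i. F i \<in> ?K"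
    and lim: "\<And>x. (\<lambda>i. F i x) \<longlonglongrightarrow> f x"
    and bnd: "\<And>i x. cmod (F i x) \<le> 2 * cmod (f x)" for f F
    unfolding L2_closure_def
  proof (intro CollectI conjI allI impI f)
    fix \<epsilon> :: real assume \<epsilon>: "\<epsilon> > 0"
    have "(\<lambda>i. L2_sq M (\<lambda>x. f x - F i x)) \<longlonglongrightarrow> 0"
      using F by (intro L2_sq_tendsto_0 f lim bnd square_integrable_measurable K_sq)
    then have "\<forall>\<^sub>F i in sequentially. L2_sq M (\<lambda>x. f x - F i x) < \<epsilon> / 4"
      using \<epsilon> by (intro order_tendstoD) auto
    then obtain i where i: "L2_sq M (\<lambda>x. f x - F i x) < \<epsilon> / 4"
      by (auto simp: eventually_sequentially)
    have "\<epsilon> / 4 > 0" using \<epsilon> by simp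
    then obtain g where g: "g \<in> C" "L2_sq M (\<lambda>x. F i x - g x) < \<epsilon> / 4"
      using F[of i] unfolding L2_closure_def by blast
    have "L2_sq M (\<lambda>x. (f x - F i x) + (F i x - g x)) < \<epsilon>"
      using L2_sq_add_le[OF square_integrable_diff[OF f K_sq[OF F[of i]]]
          square_integrable_diff[OF K_sq[OF F[of i]] C_sq[OF g(1)]]] i g by simp
    then show "\<exists>h\<in>C. L2_sq M (\<lambda>x. f x - h x) < \<epsilon>" using g by (intro bexI[of _ g]) auto
  qed
  have ind_sq: "square_integrable M (indicator B)" if "B \<in> sets borel" for B
    using that unfolding square_integrable_def
    by (intro conjI integrable_const_bound[where B = 1]) (auto simp: indicator_def)
  have K_ind: "indicator B \<in> ?K" if "B \<in> sets borel" for B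
  proof -
    have "Int_stable (range (\<lambda>a::real. {..a}))"
      by (auto simp: Int_stable_def)
    moreover have "range (\<lambda>a::real. {..a}) \<subseteq> Pow UNIV" by simp
    moreover have "B \<in> sigma_sets UNIV (range (\<lambda>a::real. {..a}))"
      using that unfolding borel_eq_atMost by simp
    ultimately show ?thesis
    proof (induction rule: sigma_sets_induct_disjoint)
      case (basic A)
      then show ?case using C_Iic by auto
    next
      case empty
      have "(\<lambda>x. 0 * 1) \<in> ?K" using K_scale[OF K_C[OF C_one], of 0] by simp
      then show ?case by (simp add: indicator_def[abs_def])
    next
      case (compl A)
      have "(\<lambda>x. 1 + (- 1) * indicator A x) \<in> ?K"
        by (rule K_add[OF K_C[OF C_one] K_scale[OF compl(2)]])
      also have "(\<lambda>x. 1 + (- 1) * indicator A x) = (indicator (UNIV - A) :: real \<Rightarrow> complex)"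
        by (auto simp: indicator_def)
      finally show ?case .
    next
      case (union A)
      have A: "A i \<in> sets borel" for i
        using union(2) unfolding borel_eq_atMost by auto
      show ?case
      proof (rule K_limit[of _ "\<lambda>n. indicator (\<Union>i<n. A i)"])
        show "square_integrable M (indicator (\<Union>i. A i))" using A by (intro ind_sq) auto
        show "indicator (\<Union>i<n. A i) \<in> ?K" for n
        proof (induction n)
          case 0
          have "(\<lambda>x. 0 * 1) \<in> ?K" using K_scale[OF K_C[OF C_one], of 0] by simp
          then show ?case by (simp add: indicator_def[abs_def])
        next
          case (Suc n)
          have "(\<lambda>x. indicator (\<Union>i<n. A i) x + indicator (A n) x) \<in> ?K"
            by (rule K_add[OF Suc union(3)])
          also have "(\<lambda>x. indicator (\<Union>i<n. A i) x + indicator (A n) x) =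
              (indicator (\<Union>i<Suc n. A i) :: real \<Rightarrow> complex)"
          proof
            fix x
            have "(\<Union>i<n. A i) \<inter> A n = {}"
              using union(1) unfolding disjoint_family_on_def by (fastforce dest: less_imp_neq)
            then show "indicator (\<Union>i<n. A i) x + indicator (A n) x =
                (indicator (\<Union>i<Suc n. A i) x :: complex)"
              unfolding lessThan_Suc by (auto simp: indicator_def)
          qed
          finally show ?case .
        qed
        show "(\<lambda>n. indicator (\<Union>i<n. A i) x) \<longlonglongrightarrow> (indicator (\<Union>i. A i) x :: complex)" for x
          by (rule LIMSEQ_indicator_UN)
      qed (auto simp: indicator_def)
    qed
  qed
  have K_sum: "(\<lambda>x. \<Sum>i\<in>I. f i x) \<in> ?K" if "finite I" "\<And>i. i \<in> I \<Longrightarrow> f i \<in> ?K"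
    for I :: "complex set" and f
    using that
  proof (induction I rule: finite_induct)
    case empty
    have "(\<lambda>x. 0 * 1) \<in> ?K" using K_scale[OF K_C[OF C_one], of 0] by simp
    then show ?case by simp
  next
    case (insert i I)
    then show ?case by (simp add: K_add)
  qed
  have K_simple: "s \<in> ?K" if s: "simple_function M s" for s
  proof -
    have "(\<lambda>x. \<Sum>y\<in>range s. y * indicator (s -` {y}) x) \<in> ?K"
    proof (intro K_sum K_scale K_ind)
      show "finite (range s)" using s by (simp add: simple_function_def)
      show "s -` {y} \<in> sets borel" if "y \<in> range s" for y
        using s that by (auto simp: simple_function_def)
    qed
    also have "(\<lambda>x. \<Sum>y\<in>range s. y * indicator (s -` {y}) x) = s"
    proof
      fix x
      have "finite (range s)" using s by (simp add: simple_function_def)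
      then have "(\<Sum>y\<in>range s. y * indicator (s -` {y}) x) = (\<Sum>y\<in>{s x}. y * indicator (s -` {y}) x)"
        by (intro sum.mono_neutral_right) (auto simp: indicator_def)
      then show "(\<Sum>y\<in>range s. y * indicator (s -` {y}) x) = s x" by simp
    qed
    finally show ?thesis .
  qed
  have "f \<in> ?K" if f: "square_integrable M f" for f
  proof -
    obtain F where F: "\<And>i. simple_function M (F i)" "\<And>x. (\<lambda>i. F i x) \<longlonglongrightarrow> f x"
      "\<And>i x. cmod (F i x) \<le> 2 * cmod (f x)"
      using borel_measurable_implies_sequence_metric[OF square_integrable_measurable[OF f], of 0]
      by (auto simp: dist_norm)
    then show ?thesis using K_limit[OF f, of F] K_simple by blast
  qed
  then show ?thesis using C_sq unfolding L2_dense_def L2_closure_def by blast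
qed

definition step_functions :: "(nat \<Rightarrow> nat) \<Rightarrow> (real \<Rightarrow> complex) set" where
  "step_functions r = {\<lambda>x. g \<lfloor>real (r n) * x\<rfloor> | n (g :: int \<Rightarrow> complex). bounded (range g)}"

text \<open>
  The divisibility makes the partitions nested, so that step functions form a linear space. Since the
  cells shrink, the step function that marks the cells up to the one containing \<open>a\<close> converges pointwise to the
  indicator of \<open>{..a}\<close>.
\<close>

lemma step_functions_L2_dense:
  assumes "real_distribution M" and dvd: "\<And>n. r n dvd r (Suc n)" and pos: "\<And>n. r n > 0"
    and lim: "filterlim (\<lambda>n. real (r n)) at_top sequentially"
  shows "L2_dense M (step_functions r)"
proof -
  interpret real_distribution M by fact
  have meas: "(\<lambda>x. g \<lfloor>real (r n) * x\<rfloor>) \<in> borel_measurable borel" for n and g :: "int \<Rightarrow> complex"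
    by (rule measurable_compose[where N = "count_space UNIV"]) auto
  have sq: "square_integrable M (\<lambda>x. g \<lfloor>real (r n) * x\<rfloor>)"
    if "bounded (range g)" for g :: "int \<Rightarrow> complex" and n
  proof -
    obtain B where "\<And>j. cmod (g j) \<le> B" using \<open>bounded (range g)\<close> by (auto simp: bounded_iff)
    then have B2: "(cmod (g j))\<^sup>2 \<le> B\<^sup>2" for j by (intro power_mono) auto
    show ?thesis
      unfolding square_integrable_def using meas[of g n]
      by (intro conjI integrable_const_bound[where B = "B\<^sup>2"]) (auto simp: B2)
  qed
  have refine: "\<exists>g'. bounded (range g') \<and> (\<lambda>x. g \<lfloor>real (r n) * x\<rfloor>) = (\<lambda>x. g' \<lfloor>real (r m) * x\<rfloor>)"
    if nm: "n \<le> m" and g: "bounded (range g)" for n m and g :: "int \<Rightarrow> complex"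
  proof -
    have "r n dvd r m"
      using nm by (induction rule: dec_induct) (auto intro: dvd dvd_trans)
    then obtain k where k: "r m = r n * k" by (elim dvdE)
    then have k0: "k > 0" using pos[of m] by (auto intro: gr0I)
    have "\<lfloor>real (r n) * x\<rfloor> = \<lfloor>real (r m) * x\<rfloor> div int k" for x
      using k0 floor_divide_real_eq_div[of "int k" "real (r m) * x"] by (simp add: k)
    moreover have "bounded (range (\<lambda>j. g (j div int k)))"
      by (rule bounded_subset[OF g]) auto
    ultimately show ?thesis by (intro exI[of _ "\<lambda>j. g (j div int k)"]) auto
  qed
  show ?thesis
  proof (rule L2_dense_if_half_lines)
    show "real_distribution M" by fact
    show "square_integrable M g" if "g \<in> step_functions r" for g
      using that sq by (auto simp: step_functions_def)
    show "(\<lambda>_. 1) \<in> step_functions r"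
      unfolding step_functions_def by (intro CollectI exI[of _ 0] exI[of _ "\<lambda>_. 1"]) auto
    show "(\<lambda>x. c * f x) \<in> step_functions r" if f: "f \<in> step_functions r" for f c
    proof -
      obtain n g where g: "bounded (range g)" "f = (\<lambda>x. g \<lfloor>real (r n) * x\<rfloor>)"
        using f by (auto simp: step_functions_def)
      obtain B where "\<And>j. cmod (g j) \<le> B" using g(1) by (auto simp: bounded_iff)
      then have "bounded (range (\<lambda>j. c * g j))"
        by (intro boundedI[where B = "cmod c * B"]) (auto simp: norm_mult intro!: mult_left_mono)
      then show ?thesis
        unfolding step_functions_def g(2) by (intro CollectI exI[of _ n] exI[of _ "\<lambda>j. c * g j"]) auto
    qed
    show "(\<lambda>x. f x + f' x) \<in> step_functions r"
      if f: "f \<in> step_functions r" and f': "f' \<in> step_functions r" for f f'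
    proof -
      obtain n g where g: "bounded (range g)" "f = (\<lambda>x. g \<lfloor>real (r n) * x\<rfloor>)"
        using f by (auto simp: step_functions_def)
      obtain n' g' where g': "bounded (range g')" "f' = (\<lambda>x. g' \<lfloor>real (r n') * x\<rfloor>)"
        using f' by (auto simp: step_functions_def)
      obtain h where h: "bounded (range h)" "f = (\<lambda>x. h \<lfloor>real (r (max n n')) * x\<rfloor>)"
        using refine[of n "max n n'" g] g by auto
      obtain h' where h': "bounded (range h')" "f' = (\<lambda>x. h' \<lfloor>real (r (max n n')) * x\<rfloor>)"
        using refine[of n' "max n n'" g'] g' by auto
      have "bounded (range (\<lambda>j. h j + h' j))"
      proof -
        obtain B B' where B: "\<And>j. cmod (h j) \<le> B" "\<And>j. cmod (h' j) \<le> B'"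
          using h(1) h'(1) by (auto simp: bounded_iff)
        have "cmod (h j + h' j) \<le> B + B'" for j
          by (rule order_trans[OF norm_triangle_ineq add_mono[OF B]])
        then show ?thesis by (intro boundedI[where B = "B + B'"]) auto
      qed
      then show ?thesis
        unfolding step_functions_def h(2) h'(2)
        by (intro CollectI exI[of _ "max n n'"] exI[of _ "\<lambda>j. h j + h' j"]) auto
    qed
    show "indicator {..a} \<in> L2_closure M (step_functions r)" for a
      unfolding L2_closure_def
    proof (intro CollectI conjI allI impI)
      show ind: "square_integrable M (indicator {..a})"
        unfolding square_integrable_def
        by (intro conjI integrable_const_bound[where B = 1]) (auto simp: indicator_def)
      define s where "s n x = (indicator {..\<lfloor>real (r n) * a\<rfloor>} \<lfloor>real (r n) * x\<rfloor> :: complex)" for n x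
      have s_bdd: "bounded (range (indicator {..\<lfloor>real (r n) * a\<rfloor>} :: int \<Rightarrow> complex))" for n
        by (intro boundedI[where B = 1]) (auto simp: indicator_def)
      have s: "s n \<in> step_functions r" for n
        unfolding step_functions_def s_def[abs_def] using s_bdd[of n] by blast
      have [measurable]: "s n \<in> borel_measurable borel" for n
        unfolding s_def[abs_def] by (rule meas)
      have conv: "(\<lambda>n. s n x) \<longlonglongrightarrow> indicator {..a} x" for x
      proof (cases "x \<le> a")
        case True
        then have "s n x = indicator {..a} x" for n
          by (auto simp: s_def indicator_def intro!: floor_mono mult_left_mono)
        then show ?thesis by simp
      next
        case False
        have "\<forall>\<^sub>F n in sequentially. real (r n) \<ge> 1 / (x - a)"
          using lim by (simp add: filterlim_at_top)
        then have "\<forall>\<^sub>F n in sequentially. s n x = indicator {..a} x"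
        proof eventually_elim
          case (elim n)
          then have "real (r n) * x \<ge> real (r n) * a + 1"
            using False by (simp add: field_simps)
          then have "\<lfloor>real (r n) * x\<rfloor> \<ge> \<lfloor>real (r n) * a + 1\<rfloor>" by (rule floor_mono)
          then show ?case using False by (simp add: s_def)
        qed
        then show ?thesis by (rule tendsto_eventually)
      qed
      fix \<epsilon> :: real assume "\<epsilon> > 0"
      have "(\<lambda>n. L2_sq M (\<lambda>x. indicator {..a} x - s n x)) \<longlonglongrightarrow> (LINT x|M. 0)"
        unfolding L2_sq_def
      proof (rule integral_dominated_convergence[where w = "\<lambda>_. 1"])
        show "AE x in M. (\<lambda>n. (cmod (indicator {..a} x - s n x))\<^sup>2) \<longlonglongrightarrow> 0"
        proof (rule AE_I2)
          fix x
          have "(\<lambda>n. (cmod (indicator {..a} x - s n x))\<^sup>2) \<longlonglongrightarrow> (cmod (indicator {..a} x - indicator {..a} x))\<^sup>2"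
            by (intro tendsto_intros conv)
          then show "(\<lambda>n. (cmod (indicator {..a} x - s n x))\<^sup>2) \<longlonglongrightarrow> 0" by simp
        qed
        show "AE x in M. norm ((cmod (indicator {..a} x - s n x))\<^sup>2) \<le> 1" for n
          by (rule AE_I2) (auto simp: s_def indicator_def)
      qed (auto intro!: borel_measurable_power)
      then have "\<forall>\<^sub>F n in sequentially. L2_sq M (\<lambda>x. indicator {..a} x - s n x) < \<epsilon>"
        using \<open>\<epsilon> > 0\<close> by (intro order_tendstoD) auto
      then show "\<exists>g\<in>step_functions r. L2_sq M (\<lambda>x. indicator {..a} x - g x) < \<epsilon>"
        using s by (auto simp: eventually_sequentially)
    qed
  qed
qed

section \<open>The spectrum\<close>

text \<open>
  Centring the digits at \<open>0\<close> keeps the frequencies small compared with the next radix, which is what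
  bounds the Fourier transform of the tail from below.
\<close>

definition balanced_digits :: "nat \<Rightarrow> int set" where
  "balanced_digits m = {- int (m div 2) ..< int m - int (m div 2)}"

primrec freq_set :: "(nat \<Rightarrow> nat) \<Rightarrow> (nat \<Rightarrow> nat) \<Rightarrow> nat \<Rightarrow> int set" where
  "freq_set b d 0 = {0}"
| "freq_set b d (Suc n) =
     (\<lambda>(\<zeta>, l). \<zeta> + int (rho b (Suc n)) * l) ` (freq_set b d n \<times> balanced_digits (d (Suc n)))"

declare freq_set.simps(2) [simp del]

lemma balanced_digits_bound: "l \<in> balanced_digits m \<Longrightarrow> 2 * \<bar>l\<bar> \<le> int m"
  unfolding balanced_digits_def by auto

text \<open>
  Orthogonality of the characters of the integers modulo \<open>m\<close>; any \<open>m\<close> consecutive integers form a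
  complete residue system.
\<close>

lemma sum_balanced_digits:
  fixes k :: int
  assumes "m \<ge> 1" and "\<bar>k\<bar> < int m"
  shows "(\<Sum>l\<in>balanced_digits m. expo (of_int l) (of_int k / real m)) = (if k = 0 then of_nat m else 0)"
proof -
  have im: "balanced_digits m = (\<lambda>j. int j - int (m div 2)) ` {..<m}"
  proof (intro equalityI subsetI)
    fix l assume "l \<in> balanced_digits m"
    then show "l \<in> (\<lambda>j. int j - int (m div 2)) ` {..<m}"
      unfolding balanced_digits_def
      by (intro image_eqI[of _ _ "nat (l + int (m div 2))"]) auto
  qed (auto simp: balanced_digits_def)
  have "(\<Sum>l\<in>balanced_digits m. expo (of_int l) (of_int k / real m)) =
      (\<Sum>j<m. expo (real j + - real (m div 2)) (of_int k / real m))"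
    unfolding im by (subst sum.reindex) (auto simp: inj_on_def)
  also have "\<dots> = expo (- real (m div 2)) (of_int k / real m) * (of_nat m * H_avg m (of_int k / of_nat m))"
    using assms by (simp only: expo_add_freq H_avg_def) (simp add: sum_distrib_right mult_ac)
  also have "\<dots> = (if k = 0 then of_nat m else 0)"
  proof (cases "k = 0")
    case True
    then show ?thesis using assms by (simp add: H_avg_def)
  next
    case False
    then have "\<not> int m dvd k" using assms zdvd_imp_le[of "int m" "\<bar>k\<bar>"] by auto
    then show ?thesis using H_avg_eq_0[of m k] assms False by simp
  qed
  finally show ?thesis .
qed

text \<open>
  Centring at the midpoint of \<open>[0, 1]\<close> changes the transform only by a unimodular factor, and then every
  phase \<open>2 * pi * \<xi> * (x - 1 / 2)\<close> is at most \<open>pi / 3\<close> in absolute value, where the cosine is at least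
  \<open>1 / 2\<close>.
\<close>

lemma norm_fourier_transform_ge_half:
  assumes M: "real_distribution M" and supp: "AE x in M. 0 \<le> x \<and> x \<le> 1" and \<xi>: "\<bar>\<xi>\<bar> \<le> 1 / 3"
  shows "1 / 2 \<le> cmod (fourier_transform M \<xi>)"
proof -
  interpret real_distribution M by (rule M)
  have int: "integrable M (\<lambda>x. expo \<xi> (x + - 1 / 2))"
    by (rule integrable_const_bound[where B = 1]) (auto intro!: borel_measurable_expo[THEN measurable_compose[rotated]])
  have "(1 / 2 :: real) = (LINT x|M. 1 / 2)" using prob_space by simp
  also have "\<dots> \<le> (LINT x|M. Re (expo \<xi> (x + - 1 / 2)))"
  proof (intro integral_mono_AE integrable_Re int)
    show "AE x in M. 1 / 2 \<le> Re (expo \<xi> (x + - 1 / 2))"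
      using supp
    proof eventually_elim
      case (elim x)
      then have "\<bar>x - 1 / 2\<bar> \<le> 1 / 2" by (auto simp: abs_if)
      then have "\<bar>\<xi>\<bar> * \<bar>x - 1 / 2\<bar> \<le> (1 / 3) * (1 / 2)"
        using \<xi> by (intro mult_mono) auto
      then have "(2 * pi) * (\<bar>\<xi>\<bar> * \<bar>x - 1 / 2\<bar>) \<le> (2 * pi) * (1 / 6)"
        by (intro mult_left_mono) auto
      then have le: "\<bar>2 * pi * \<xi> * (x - 1 / 2)\<bar> \<le> pi / 3"
        unfolding abs_mult by simp
      have "1 / 2 = cos (pi / 3)" by (simp add: cos_60)
      also have "\<dots> \<le> cos \<bar>2 * pi * \<xi> * (x - 1 / 2)\<bar>"
        using le by (intro cos_monotone_0_pi_le) auto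
      also have "\<dots> = Re (expo \<xi> (x + - 1 / 2))"
      proof -
        have "cos \<bar>y\<bar> = Re (iexp (- y))" for y :: real
          by (simp add: Re_exp cos_abs_real)
        moreover have "expo \<xi> (x + - 1 / 2) = iexp (- (2 * pi * \<xi> * (x - 1 / 2)))"
          by (simp add: expo_eq_iexp)
        ultimately show ?thesis by (simp only:)
      qed
      finally show ?case .
    qed
  qed auto
  also have "\<dots> = Re (CLINT x|M. expo \<xi> (x + - 1 / 2))"
    by (rule integral_Re[OF int])
  also have "\<dots> \<le> cmod (CLINT x|M. expo \<xi> (x + - 1 / 2))" by (rule complex_Re_le_cmod)
  also have "(CLINT x|M. expo \<xi> (x + - 1 / 2)) = fourier_transform M \<xi> * expo \<xi> (- 1 / 2)"
    unfolding expo_add fourier_transform_def by simp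
  finally show ?thesis by (simp add: norm_mult)
qed

context riesz_sequences
begin

abbreviation L :: "nat \<Rightarrow> int set" where "L \<equiv> freq_set b d"

lemma L_Suc: "L (Suc n) = (\<lambda>(\<zeta>, l). \<zeta> + int (R n) * l) ` (L n \<times> balanced_digits (d (Suc n)))"
  by (simp add: freq_set.simps(2) R_def)

lemma L_finite [simp]: "finite (L n)"
  by (induction n) (auto simp: L_Suc balanced_digits_def)

lemma L_mono: "L n \<subseteq> L (Suc n)"
proof
  fix \<zeta> assume "\<zeta> \<in> L n"
  moreover have "0 \<in> balanced_digits (d (Suc n))"
    using d_ge[of "Suc n"] by (auto simp: balanced_digits_def)
  ultimately show "\<zeta> \<in> L (Suc n)"
    unfolding L_Suc by (intro image_eqI[of _ _ "(\<zeta>, 0)"]) auto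
qed

text \<open>
  The new top digit contributes at most \<open>R n * d / 2 \<le> R (n + 1) / 4\<close>, the lower ones at most
  \<open>R n / 3 \<le> R (n + 1) / 12\<close>, and the two bounds add up to \<open>R (n + 1) / 3\<close>.
\<close>

lemma L_bound: "\<zeta> \<in> L n \<Longrightarrow> 3 * \<bar>\<zeta>\<bar> \<le> int (R n)"
proof (induction n arbitrary: \<zeta>)
  case (Suc n)
  then obtain \<kappa> l where l: "\<zeta> = \<kappa> + int (R n) * l" "\<kappa> \<in> L n" "l \<in> balanced_digits (d (Suc n))"
    by (auto simp: L_Suc)
  have "6 * \<bar>\<zeta>\<bar> \<le> 2 * (3 * \<bar>\<kappa>\<bar>) + int (R n) * (3 * (2 * \<bar>l\<bar>))"
    unfolding l(1) using abs_triangle_ineq[of \<kappa> "int (R n) * l"] by (simp add: abs_mult)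
  also have "\<dots> \<le> 2 * int (R n) + int (R n) * (3 * int (d (Suc n)))"
    using Suc.IH[OF l(2)] balanced_digits_bound[OF l(3)] by (intro add_mono mult_left_mono) auto
  also have "\<dots> = int (R n) * (2 + 3 * int (d (Suc n)))" by (simp add: algebra_simps)
  also have "\<dots> \<le> int (R n) * (2 * int (b (Suc n)))"
    using b_ge[of "Suc n"] d_ge[of "Suc n"] by (intro mult_left_mono) auto
  finally show ?case by (simp add: R_Suc)
qed simp

lemma R_dvd: "k \<le> n \<Longrightarrow> R k dvd R n"
  by (induction rule: dec_induct) (auto simp: R_Suc intro: dvd_trans)

lemma R_d_dvd: "k < n \<Longrightarrow> R k * d (Suc k) dvd R n"
proof -
  assume "k < n"
  have "R k * d (Suc k) dvd R (Suc k)" using d_dvd[of "Suc k"] by (simp add: R_Suc)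
  also have "\<dots> dvd R n" using \<open>k < n\<close> by (intro R_dvd) auto
  finally show ?thesis .
qed

text \<open>
  The index \<open>k\<close> is the lowest position at which the two digit expansions differ. Both the
  orthogonality of the exponentials and the uniqueness of the expansions follow from it.
\<close>

lemma L_separated:
  assumes "\<zeta> \<in> L n" "\<kappa> \<in> L n" "\<zeta> \<noteq> \<kappa>"
  shows "\<exists>k<n. int (R k) dvd \<zeta> - \<kappa> \<and> \<not> int (R k * d (Suc k)) dvd \<zeta> - \<kappa>"
  using assms
proof (induction n arbitrary: \<zeta> \<kappa>)
  case (Suc n)
  obtain \<alpha> l where l: "\<zeta> = \<alpha> + int (R n) * l" "\<alpha> \<in> L n" "l \<in> balanced_digits (d (Suc n))"
    using Suc.prems by (auto simp: L_Suc)
  obtain \<beta> l' where l': "\<kappa> = \<beta> + int (R n) * l'" "\<beta> \<in> L n" "l' \<in> balanced_digits (d (Suc n))"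
    using Suc.prems by (auto simp: L_Suc)
  have diff: "\<zeta> - \<kappa> = (\<alpha> - \<beta>) + int (R n) * (l - l')"
    unfolding l(1) l'(1) by (simp add: algebra_simps)
  show ?case
  proof (cases "\<alpha> = \<beta>")
    case True
    then have "l \<noteq> l'" using Suc.prems l l' by auto
    moreover have "\<bar>l - l'\<bar> < int (d (Suc n))"
      using l(3) l'(3) by (auto simp: balanced_digits_def)
    ultimately have "\<not> int (d (Suc n)) dvd l - l'"
      using zdvd_imp_le[of "int (d (Suc n))" "\<bar>l - l'\<bar>"] by auto
    then show ?thesis using True unfolding diff by (intro exI[of _ n]) auto
  next
    case False
    then obtain k where k: "k < n" "int (R k) dvd \<alpha> - \<beta>" "\<not> int (R k * d (Suc k)) dvd \<alpha> - \<beta>"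
      using Suc.IH l l' by blast
    have "int (R k) dvd int (R n) * (l - l')" "int (R k * d (Suc k)) dvd int (R n) * (l - l')"
      using R_dvd[of k n] R_d_dvd[of k n] k(1) by (auto intro: dvd_mult2 simp del: of_nat_mult)
    then show ?thesis
      unfolding diff using k by (intro exI[of _ k]) (auto simp: dvd_add_left_iff simp del: of_nat_mult)
  qed
qed simp

lemma L_inj: "inj_on (\<lambda>(\<zeta>, l). \<zeta> + int (R n) * l) (L n \<times> B)"
proof -
  have "\<alpha> = \<beta> \<and> l = l'" if mem: "\<alpha> \<in> L n" "\<beta> \<in> L n" and eq: "\<alpha> + int (R n) * l = \<beta> + int (R n) * l'"
    for \<alpha> \<beta> l l'
  proof -
    have *: "\<alpha> - \<beta> = int (R n) * (l' - l)" using eq by (simp add: algebra_simps)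
    have "\<alpha> = \<beta>"
    proof (rule ccontr)
      assume "\<alpha> \<noteq> \<beta>"
      then obtain k where "k < n" "\<not> int (R k * d (Suc k)) dvd \<alpha> - \<beta>"
        using L_separated[OF mem] by blast
      moreover have "int (R k * d (Suc k)) dvd int (R n)" if "k < n" for k
        using R_d_dvd[OF that] by (simp only: of_nat_dvd_iff)
      ultimately show False unfolding * by (auto intro: dvd_mult2 simp del: of_nat_mult)
    qed
    then show ?thesis using * R_pos[of n] by auto
  qed
  note unique = this
  show ?thesis
    unfolding inj_on_def case_prod_unfold
  proof (intro ballI impI prod_eqI)
    fix x y
    assume "x \<in> L n \<times> B" "y \<in> L n \<times> B"
      and "fst x + int (R n) * snd x = fst y + int (R n) * snd y"
    then show "fst x = fst y" "snd x = snd y"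
      using unique[of "fst x" "fst y" "snd x" "snd y"] by auto
  qed
qed

lemma L_sum:
  fixes f :: "int \<Rightarrow> 'c::comm_monoid_add"
  shows "(\<Sum>\<zeta>\<in>L (Suc n). f \<zeta>) = (\<Sum>\<zeta>\<in>L n. \<Sum>l\<in>balanced_digits (d (Suc n)). f (\<zeta> + int (R n) * l))"
  unfolding L_Suc by (subst sum.reindex[OF L_inj])
    (simp add: sum.cartesian_product case_prod_unfold)

lemma fourier_\<mu>_zero:
  assumes "int (R k) dvd j" "\<not> int (R k * d (Suc k)) dvd j"
  shows "fourier_transform \<mu> (of_int j) = 0"
proof -
  let ?h = "\<lambda>k. H_avg (d (Suc k)) (of_int j / (real (d (Suc k)) * real (rho b (Suc k))))"
  obtain l where l: "j = int (R k) * l" using assms(1) by (elim dvdE)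
  then have nd: "\<not> int (d (Suc k)) dvd l" using assms(2) by auto
  have "?h k = H_avg (d (Suc k)) (of_int l / of_nat (d (Suc k)))"
    unfolding R_def[symmetric] l using R_pos[of k] by (simp add: field_simps)
  also have "\<dots> = 0" using nd d_ge[of "Suc k"] by (intro H_avg_eq_0) auto
  finally have z: "?h k = 0" .
  have "(\<lambda>M. \<Prod>k<M. ?h k) \<longlonglongrightarrow> fourier_transform \<mu> (of_int j)"
    using is_riesz_\<mu> by (intro has_prod_imp_tendsto') (auto simp: is_riesz_product_measure_def)
  moreover have "(\<lambda>M. \<Prod>k<M. ?h k) \<longlonglongrightarrow> 0"
  proof (rule tendsto_eventually)
    show "\<forall>\<^sub>F M in sequentially. (\<Prod>k<M. ?h k) = 0"
      using eventually_gt_at_top[of k] by eventually_elim (use z in auto)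
  qed
  ultimately show ?thesis by (rule LIMSEQ_unique)
qed

definition \<Lambda> :: "real set" where "\<Lambda> = of_int ` (\<Union>n. L n)"

lemma L_mono': "m \<le> n \<Longrightarrow> L m \<subseteq> L n"
  by (rule lift_Suc_mono_le[of L]) (use L_mono in auto)

lemma expo_orthonormal: "orthonormal \<mu> \<Lambda> expo"
  unfolding orthonormal_def
proof (intro conjI ballI)
  interpret M: real_distribution \<mu> by (rule real_distribution_\<mu>)
  fix x y assume "x \<in> \<Lambda>" "y \<in> \<Lambda>"
  then obtain \<kappa> \<eta> m n where xy: "x = of_int \<kappa>" "y = of_int \<eta>" and mn: "\<kappa> \<in> L m" "\<eta> \<in> L n"
    unfolding \<Lambda>_def by auto
  then have L: "\<kappa> \<in> L (max m n)" "\<eta> \<in> L (max m n)"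
    using L_mono'[of m "max m n"] L_mono'[of n "max m n"] by auto
  have "L2_inner \<mu> (expo x) (expo y) = fourier_transform \<mu> (of_int (\<kappa> - \<eta>))"
    unfolding L2_inner_def fourier_transform_def xy cnj_expo expo_add_freq[symmetric] by simp
  also have "\<dots> = (if x = y then 1 else 0)"
  proof (cases "\<kappa> = \<eta>")
    case True
    then show ?thesis
      using M.prob_space by (simp add: fourier_transform_def xy expo_def)
  next
    case False
    then obtain k where "int (R k) dvd \<kappa> - \<eta>" "\<not> int (R k * d (Suc k)) dvd \<kappa> - \<eta>"
      using L_separated[OF L] by blast
    then have "fourier_transform \<mu> (of_int (\<kappa> - \<eta>)) = 0" by (rule fourier_\<mu>_zero)
    then show ?thesis using False xy by simp
  qed
  finally show "L2_inner \<mu> (expo x) (expo y) = (if x = y then 1 else 0)" .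
next
  interpret M: real_distribution \<mu> by (rule real_distribution_\<mu>)
  fix x show "square_integrable \<mu> (expo x)"
    unfolding square_integrable_def by simp
qed

text \<open>
  The exponential matrix indexed by \<open>L n\<close> and \<open>A n\<close> is \<open>sqrt (N n)\<close> times a unitary matrix. In the
  induction step the new frequency digit sees only the difference of the new position digits, because
  its product with the older position digits is an integer. Summing over it gives \<open>0\<close> unless the new
  position digits agree, and then the previous level remains.
\<close>

lemma sum_L_expo:
  assumes "m \<in> A n" "m' \<in> A n"
  shows "(\<Sum>\<zeta>\<in>L n. expo (of_int \<zeta>) (of_int (int m - int m') / real (R n))) =
    (if m = m' then of_nat (N n) else 0)"
  using assms
proof (induction n arbitrary: m m')
  case (Suc n)
  obtain u a where m: "m = u * b (Suc n) + a * q (Suc n)" "u \<in> A n" "a < d (Suc n)"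
    using Suc.prems by (auto simp: A_Suc)
  obtain u' a' where m': "m' = u' * b (Suc n) + a' * q (Suc n)" "u' \<in> A n" "a' < d (Suc n)"
    using Suc.prems by (auto simp: A_Suc)
  define U where "U = int u - int u'"
  define D where "D = int a - int a'"
  define x where "x = of_int (int m - int m') / real (R (Suc n))"
  have R': "real (R n) > 0" "real (b (Suc n)) > 0" "real (d (Suc n)) > 0" "real (q (Suc n)) > 0"
    using b_ge4[of "Suc n"] d_ge[of "Suc n"] q_ge[of "Suc n"] by auto
  have x: "x = of_int U / real (R n) + of_int D / (real (R n) * real (d (Suc n)))"
    unfolding x_def U_def D_def m(1) m'(1) R_Suc b_eq[of "Suc n", simplified]
    using R' by (simp add: field_simps)
  have step: "expo (of_int (\<zeta> + int (R n) * l)) x =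
      expo (of_int \<zeta>) x * expo (of_int l) (of_int D / real (d (Suc n)))" for \<zeta> l
  proof -
    have "expo (of_int (\<zeta> + int (R n) * l)) x = expo (of_int \<zeta>) x * expo (real (R n) * of_int l) x"
      by (simp add: expo_add_freq)
    also have "expo (real (R n) * of_int l) x = expo 1 (of_int l * (real (R n) * x))"
      by (simp add: expo_def mult_ac)
    also have "of_int l * (real (R n) * x) = of_int l * of_int U + of_int l * (of_int D / real (d (Suc n)))"
      unfolding x using R' by (simp add: field_simps)
    also have "expo 1 \<dots> = expo (of_int l * of_int U) 1 * expo (of_int l) (of_int D / real (d (Suc n)))"
      unfolding expo_add by (simp add: expo_def mult_ac)
    finally show ?thesis by (simp add: expo_int_mult)
  qed
  have "\<bar>D\<bar> < int (d (Suc n))" using m(3) m'(3) by (simp add: D_def)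
  then have inner: "(\<Sum>l\<in>balanced_digits (d (Suc n)). expo (of_int l) (of_int D / real (d (Suc n)))) =
      (if D = 0 then of_nat (d (Suc n)) else 0)"
    using d_ge[of "Suc n"] by (intro sum_balanced_digits) auto
  have "(\<Sum>\<zeta>\<in>L (Suc n). expo (of_int \<zeta>) x) =
      (\<Sum>\<zeta>\<in>L n. expo (of_int \<zeta>) x) * (if D = 0 then of_nat (d (Suc n)) else 0)"
    unfolding L_sum step inner[symmetric] sum_product by simp
  also have "\<dots> = (if m = m' then of_nat (N (Suc n)) else 0)"
  proof (cases "D = 0")
    case True
    then have "a = a'" by (simp add: D_def)
    then have "m = m' \<longleftrightarrow> u = u'" using m m' R' by auto
    moreover have "x = of_int (int u - int u') / real (R n)" using True by (simp add: x U_def)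
    ultimately show ?thesis using Suc.IH[OF m(2) m'(2)] True by (simp add: N_Suc)
  next
    case False
    then have "m \<noteq> m'" using m m' inj_onD[OF inj_A[of n "A n"], of "(u, a)" "(u', a')"]
      by (auto simp: D_def)
    then show ?thesis using False by simp
  qed
  finally show ?case by (simp add: x_def)
qed simp

lemma parseval_digits:
  "(\<Sum>\<zeta>\<in>L n. (cmod (\<Sum>m\<in>A n. G m * expo (- of_int \<zeta>) (real m / real (R n))))\<^sup>2) =
    real (N n) * (\<Sum>m\<in>A n. (cmod (G m))\<^sup>2)"
proof -
  let ?e = "\<lambda>\<zeta> m. expo (- of_int \<zeta>) (real m / real (R n))"
  have prod_e: "?e \<zeta> m * cnj (?e \<zeta> m') = expo (of_int \<zeta>) (of_int (int m' - int m) / real (R n))" for \<zeta> m m'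
    by (simp add: cnj_expo) (simp add: expo_def exp_add[symmetric] diff_divide_distrib algebra_simps)
  have "complex_of_real (\<Sum>\<zeta>\<in>L n. (cmod (\<Sum>m\<in>A n. G m * ?e \<zeta> m))\<^sup>2) =
      (\<Sum>\<zeta>\<in>L n. (\<Sum>m\<in>A n. G m * ?e \<zeta> m) * cnj (\<Sum>m\<in>A n. G m * ?e \<zeta> m))"
    by (simp only: of_real_sum complex_norm_square)
  also have "\<dots> = (\<Sum>\<zeta>\<in>L n. \<Sum>m\<in>A n. \<Sum>m'\<in>A n. G m * cnj (G m') * (?e \<zeta> m * cnj (?e \<zeta> m')))"
    by (simp add: sum_product mult_ac)
  also have "\<dots> = (\<Sum>m\<in>A n. \<Sum>\<zeta>\<in>L n. \<Sum>m'\<in>A n. G m * cnj (G m') * (?e \<zeta> m * cnj (?e \<zeta> m')))"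
    by (rule sum.swap)
  also have "\<dots> = (\<Sum>m\<in>A n. \<Sum>m'\<in>A n. \<Sum>\<zeta>\<in>L n. G m * cnj (G m') * (?e \<zeta> m * cnj (?e \<zeta> m')))"
    by (intro sum.cong[OF refl] sum.swap)
  also have "\<dots> = (\<Sum>m\<in>A n. \<Sum>m'\<in>A n. G m * cnj (G m') * (if m' = m then of_nat (N n) else 0))"
    unfolding prod_e sum_distrib_left[symmetric] by (intro sum.cong refl arg_cong2[where f = "(*)"] sum_L_expo)
  also have "\<dots> = (\<Sum>m\<in>A n. G m * cnj (G m) * of_nat (N n))"
    by (intro sum.cong refl) (simp add: if_distrib sum.delta cong: if_cong)
  also have "\<dots> = complex_of_real (real (N n) * (\<Sum>m\<in>A n. (cmod (G m))\<^sup>2))"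
    by (simp only: of_real_mult of_real_sum complex_norm_square sum_distrib_left of_real_of_nat_eq mult_ac)
  finally show ?thesis by (simp only: of_real_eq_iff)
qed

text \<open>
  On a cell of level \<open>n\<close> the function is constant, so by self-similarity each coefficient factors into
  a finite Fourier coefficient and the transform of \<open>tail n\<close>. Parseval's identity handles the first,
  and the lower bound \<open>1 / 2\<close> the second.
\<close>

lemma step_frame_bound:
  assumes "g \<in> step_functions R"
  shows "\<exists>F. finite F \<and> F \<subseteq> \<Lambda> \<and> 1 / 4 * L2_sq \<mu> g \<le> (\<Sum>x\<in>F. (cmod (L2_inner \<mu> g (expo x)))\<^sup>2)"
proof -
  interpret M: real_distribution \<mu> by (rule real_distribution_\<mu>)
  obtain n and G :: "int \<Rightarrow> complex" where G: "bounded (range G)" and g: "g = (\<lambda>x. G \<lfloor>real (R n) * x\<rfloor>)"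
    using assms by (auto simp: step_functions_def)
  interpret T: real_distribution "tail n" by (rule real_distribution_tail)
  have dense: "L2_dense \<mu> (step_functions R)"
    by (intro step_functions_L2_dense real_distribution_\<mu> filterlim_R R_pos) (simp add: R_Suc)
  then have gsq: "square_integrable \<mu> g" using assms by (simp add: L2_dense_def)
  have esq: "square_integrable \<mu> (expo x)" for x
    unfolding square_integrable_def by simp
  have cell: "AE x in tail n. g ((real m + x) / real (R n)) = G (int m)" for m
    using tail_support[of n]
  proof eventually_elim
    case (elim x)
    then have "\<lfloor>real (R n) * ((real m + x) / real (R n))\<rfloor> = int m"
      by (simp add: floor_eq_iff)
    then show ?case by (simp add: g)
  qed
  have [measurable]: "g \<in> borel_measurable borel"
    using square_integrable_measurable[OF gsq] by simp
  have norm_g: "L2_sq \<mu> g = (1 / real (N n)) * (\<Sum>m\<in>A n. (cmod (G (int m)))\<^sup>2)"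
  proof -
    have "(LINT x|tail n. (cmod (g ((real m + x) / real (R n))))\<^sup>2) = (cmod (G (int m)))\<^sup>2" for m
    proof -
      have "(LINT x|tail n. (cmod (g ((real m + x) / real (R n))))\<^sup>2) = (LINT x|tail n. (cmod (G (int m)))\<^sup>2)"
      proof (rule integral_cong_AE)
        show "AE x in tail n. (cmod (g ((real m + x) / real (R n))))\<^sup>2 = (cmod (G (int m)))\<^sup>2"
          using cell[of m] by eventually_elim simp
      qed measurable
      then show ?thesis using T.prob_space by simp
    qed
    then show ?thesis
      unfolding L2_sq_def by (simp add: integral_self_similar[OF square_integrable_integrable[OF gsq], where n = n])
  qed
  have inner_g: "L2_inner \<mu> g (expo (of_int \<zeta>)) = (1 / of_nat (N n)) *
      (\<Sum>m\<in>A n. G (int m) * expo (- of_int \<zeta>) (real m / real (R n))) *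
      fourier_transform (tail n) (- of_int \<zeta> / real (R n))" for \<zeta>
  proof -
    have "(CLINT x|tail n. g ((real m + x) / real (R n)) * cnj (expo (of_int \<zeta>) ((real m + x) / real (R n)))) =
       G (int m) * expo (- of_int \<zeta>) (real m / real (R n)) * fourier_transform (tail n) (- of_int \<zeta> / real (R n))" for m
    proof -
      have "(CLINT x|tail n. g ((real m + x) / real (R n)) * cnj (expo (of_int \<zeta>) ((real m + x) / real (R n)))) =
         (CLINT x|tail n. G (int m) * expo (- of_int \<zeta>) (real m / real (R n)) * expo (- of_int \<zeta> / real (R n)) x)"
      proof (rule integral_cong_AE)
        show "AE x in tail n. g ((real m + x) / real (R n)) * cnj (expo (of_int \<zeta>) ((real m + x) / real (R n))) =
            G (int m) * expo (- of_int \<zeta>) (real m / real (R n)) * expo (- of_int \<zeta> / real (R n)) x"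
          using cell[of m] by eventually_elim (simp add: cnj_expo add_divide_distrib expo_add expo_divide)
      qed (simp_all add: cnj_expo)
      then show ?thesis by (simp add: fourier_transform_def)
    qed
    moreover have "L2_inner \<mu> g (expo (of_int \<zeta>)) = (1 / real (N n)) *\<^sub>R (\<Sum>m\<in>A n. CLINT x|tail n.
        g ((real m + x) / real (R n)) * cnj (expo (of_int \<zeta>) ((real m + x) / real (R n))))"
      unfolding L2_inner_def by (rule integral_self_similar[OF L2_inner_integrable[OF gsq esq]])
    ultimately show ?thesis
      by (simp add: scaleR_conv_of_real sum_distrib_right)
  qed
  have ft: "1 / 2 \<le> cmod (fourier_transform (tail n) (- of_int \<zeta> / real (R n)))" if "\<zeta> \<in> L n" for \<zeta>
  proof (rule norm_fourier_transform_ge_half[OF real_distribution_tail tail_support_unit])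
    have "real_of_int (3 * \<bar>\<zeta>\<bar>) \<le> real_of_int (int (R n))"
      using L_bound[OF that] by (simp only: of_int_le_iff)
    then show "\<bar>- of_int \<zeta> / real (R n)\<bar> \<le> 1 / 3"
      using R_pos[of n] by (simp add: abs_divide field_simps)
  qed
  let ?F = "of_int ` L n :: real set"
  let ?S = "\<lambda>\<zeta>. \<Sum>m\<in>A n. G (int m) * expo (- of_int \<zeta>) (real m / real (R n))"
  have "1 / 4 * L2_sq \<mu> g = (\<Sum>\<zeta>\<in>L n. (1 / 4) * (cmod ((1 / of_nat (N n)) * ?S \<zeta>))\<^sup>2)"
    unfolding norm_g sum_distrib_left[symmetric] norm_mult power_mult_distrib
      parseval_digits[of "\<lambda>m. G (int m)" n]
    by (simp add: norm_divide power2_eq_square)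
  also have "\<dots> \<le> (\<Sum>\<zeta>\<in>L n. (cmod (L2_inner \<mu> g (expo (of_int \<zeta>))))\<^sup>2)"
  proof (rule sum_mono)
    fix \<zeta> assume "\<zeta> \<in> L n"
    from ft[OF this] have "(1 / 2)\<^sup>2 \<le> (cmod (fourier_transform (tail n) (- of_int \<zeta> / real (R n))))\<^sup>2"
      by (intro power_mono) auto
    then have "(1 / 4) * (cmod ((1 / of_nat (N n)) * ?S \<zeta>))\<^sup>2 \<le>
        (cmod (fourier_transform (tail n) (- of_int \<zeta> / real (R n))))\<^sup>2 * (cmod ((1 / of_nat (N n)) * ?S \<zeta>))\<^sup>2"
      by (intro mult_right_mono) (auto simp: power2_eq_square)
    also have "\<dots> = (cmod (L2_inner \<mu> g (expo (of_int \<zeta>))))\<^sup>2"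
      unfolding inner_g norm_mult power_mult_distrib by simp
    finally show "(1 / 4) * (cmod ((1 / of_nat (N n)) * ?S \<zeta>))\<^sup>2 \<le> (cmod (L2_inner \<mu> g (expo (of_int \<zeta>))))\<^sup>2" .
  qed
  also have "\<dots> = (\<Sum>x\<in>?F. (cmod (L2_inner \<mu> g (expo x)))\<^sup>2)"
    by (subst sum.reindex) (auto simp: inj_on_def)
  finally show ?thesis
    by (intro exI[of _ ?F]) (auto simp: \<Lambda>_def)
qed

theorem spectral_\<mu>: "spectral_measure \<mu>"
proof -
  have "L2_dense \<mu> (step_functions R)"
    by (intro step_functions_L2_dense real_distribution_\<mu> filterlim_R R_pos) (simp add: R_Suc)
  then have "L2_orthonormal_basis \<mu> \<Lambda> expo"
    by (rule frame_bound_imp_basis[OF expo_orthonormal _ _ _ step_frame_bound]) auto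
  moreover have "countable \<Lambda>" unfolding \<Lambda>_def by auto
  ultimately show ?thesis
    using is_riesz_\<mu> unfolding spectral_measure_def is_spectrum_def is_riesz_product_measure_def by blast
qed

end

section \<open>Hausdorff dimension\<close>

lemma partial_sums_bdd_above:
  fixes S :: "nat \<Rightarrow> real"
  assumes "\<forall>\<^sub>F n in sequentially. S (Suc n) \<le> S n"
  shows "\<exists>B. \<forall>n. S n \<le> B"
proof -
  obtain K where K: "\<And>n. n \<ge> K \<Longrightarrow> S (Suc n) \<le> S n"
    using assms by (auto simp: eventually_sequentially)
  have late: "S n \<le> S K" if "n \<ge> K" for n
    using that by (induction rule: dec_induct) (use K order_trans in blast)+
  have "S n \<le> Max (S ` {..K})" for n
  proof (cases "n \<le> K")
    case False
    then show ?thesis using late[of n] by (intro order_trans[OF _ Max_ge[of _ "S K"]]) auto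
  qed (auto intro: Max_ge)
  then show ?thesis by blast
qed

lemma partial_sums_at_top:
  fixes S :: "nat \<Rightarrow> real"
  assumes "c > 0" and "\<forall>\<^sub>F n in sequentially. S (Suc n) \<ge> S n + c"
  shows "filterlim S at_top sequentially"
proof -
  obtain K where K: "\<And>n. n \<ge> K \<Longrightarrow> S (Suc n) \<ge> S n + c"
    using assms by (auto simp: eventually_sequentially)
  have late: "S n \<ge> S K + c * (real n - real K)" if "n \<ge> K" for n
    using that
  proof (induction rule: dec_induct)
    case (step n)
    then show ?case using K[of n] by (simp add: algebra_simps)
  qed simp
  have "filterlim (\<lambda>n. (S K - c * real K) + c * real n) at_top sequentially"
    using assms(1)
    by (intro filterlim_tendsto_add_at_top[OF tendsto_const]
        filterlim_tendsto_pos_mult_at_top[OF tendsto_const] filterlim_real_sequentially)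
  then show ?thesis
    by (rule filterlim_at_top_mono)
      (use late in \<open>auto simp: eventually_sequentially algebra_simps intro!: exI[of _ K]\<close>)
qed

lemma subset_interval_diameter:
  fixes U :: "real set"
  assumes "bounded U" "U \<noteq> {}"
  shows "U \<subseteq> {Inf U .. Inf U + diameter U}"
proof
  fix x assume x: "x \<in> U"
  have "x - diameter U \<le> Inf U"
  proof (rule cInf_greatest[OF assms(2)])
    fix y assume "y \<in> U"
    then show "x - diameter U \<le> y"
      using diameter_bounded_bound[OF assms(1) x, of y] by (simp add: dist_real_def)
  qed
  moreover have "Inf U \<le> x"
    by (rule cInf_lower[OF x bounded_imp_bdd_below[OF assms(1)]])
  ultimately show "x \<in> {Inf U .. Inf U + diameter U}" by simp
qed

text \<open>
  The sets of a cover are arbitrary, hence possibly not measurable; each is first replaced by a closed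
  interval of the same diameter that contains it. Nonempty sets have weight \<open>1\<close> for \<open>s = 0\<close>,
  although \<open>0 powr 0 = 0\<close>, so this case is settled by the total mass alone.
\<close>

lemma mass_distribution_principle:
  fixes \<mu> :: "real measure"
  assumes M: "real_distribution \<mu>" and C: "C \<ge> 1" and s: "s \<ge> 0"
    and mass: "\<And>a r. 0 \<le> r \<Longrightarrow> r < 1 \<Longrightarrow> measure \<mu> {a..a + r} \<le> C * r powr s"
    and E: "E \<in> sets \<mu>" "emeasure \<mu> E = 1"
  shows "hausdorff_measure s E \<noteq> 0"
proof
  interpret real_distribution \<mu> by (rule M)
  assume "hausdorff_measure s E = 0"
  \<comment> \<open>Scale \<open>1 / 2\<close> keeps all diameters inside the range \<open>r < 1\<close> of the mass bound.\<close>
  moreover have "hausdorff_pre s (1 / 2) E \<le> hausdorff_measure s E"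
    unfolding hausdorff_measure_def by (rule SUP_upper) simp
  ultimately have "hausdorff_pre s (1 / 2) E < ennreal (1 / (2 * C))"
    using C by simp
  then obtain U :: "nat \<Rightarrow> real set" where cover: "E \<subseteq> (\<Union>n. U n)"
    and bnd: "\<And>n. bounded (U n)" "\<And>n. diameter (U n) \<le> 1 / 2"
    and small: "(\<Sum>n. diam_powr s (U n)) < ennreal (1 / (2 * C))"
    unfolding hausdorff_pre_def Inf_less_iff by blast
  define I where "I n = (if U n = {} then {} else {Inf (U n) .. Inf (U n) + diameter (U n)})" for n
  have UI: "U n \<subseteq> I n" for n
    using subset_interval_diameter[OF bnd(1)[of n]] by (auto simp: I_def)
  have I_mass: "emeasure \<mu> (I n) \<le> ennreal C * diam_powr s (U n)" for n
  proof (cases "U n = {}")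
    case True
    then show ?thesis by (simp add: I_def)
  next
    case False
    have "measure \<mu> (I n) \<le> C * (if s = 0 then 1 else diameter (U n) powr s)"
    proof (cases "s = 0")
      case True
      then show ?thesis using order_trans[OF prob_le_1 C, of "I n"] by simp
    next
      case s0: False
      then show ?thesis
        using False mass[of "diameter (U n)" "Inf (U n)"] bnd[of n] diameter_ge_0[of "U n"] by (simp add: I_def)
    qed
    then have "emeasure \<mu> (I n) \<le> ennreal (C * (if s = 0 then 1 else diameter (U n) powr s))"
      by (simp add: emeasure_eq_measure ennreal_leI)
    also have "\<dots> = ennreal C * diam_powr s (U n)"
      using False C by (auto simp: diam_powr_def ennreal_mult)
    finally show ?thesis .
  qed
  have "1 = emeasure \<mu> E" using E by simp
  also have "\<dots> \<le> emeasure \<mu> (\<Union>n. I n)"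
  proof (rule emeasure_mono)
    show "E \<subseteq> (\<Union>n. I n)" using cover UI by blast
  qed (auto simp: I_def)
  also have "\<dots> \<le> (\<Sum>n. emeasure \<mu> (I n))"
    by (intro emeasure_subadditive_countably) (auto simp: I_def)
  also have "\<dots> \<le> (\<Sum>n. ennreal C * diam_powr s (U n))"
    by (intro suminf_le I_mass) auto
  also have "\<dots> = ennreal C * (\<Sum>n. diam_powr s (U n))"
    by simp
  also have "\<dots> \<le> ennreal C * ennreal (1 / (2 * C))"
    using small by (intro mult_left_mono) auto
  also have "\<dots> = ennreal (1 / 2)"
    using C by (simp add: ennreal_mult[symmetric])
  also have "\<dots> < ennreal 1" by (subst ennreal_less_iff) auto
  finally show False by simp
qed

context riesz_sequences
begin

text \<open>
  The elements of \<open>A (n + 1)\<close> are multiples of \<open>q (n + 1)\<close>, which is where the gaps between the cells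
  enter the lower bound for the dimension.
\<close>

lemma card_A_interval:
  fixes x y :: real
  assumes "x \<le> y"
  shows "real (card {m \<in> A (Suc n). x \<le> real m \<and> real m \<le> y}) \<le> (y - x) / real (q (Suc n)) + 1"
proof -
  let ?q = "q (Suc n)"
  let ?B = "{m \<in> A (Suc n). x \<le> real m \<and> real m \<le> y}"
  have q0: "real ?q > 0" using q_ge[of "Suc n"] by simp
  have qm: "real m = real (m div ?q) * real ?q" if "m \<in> A (Suc n)" for m
    using A_dvd[OF that] by (metis dvd_div_mult_self of_nat_mult)
  have "card ?B \<le> card {\<lceil>x / real ?q\<rceil> .. \<lfloor>y / real ?q\<rfloor>}"
  proof (rule card_inj_on_le)
    show "inj_on (\<lambda>m. int (m div ?q)) ?B"
      by (rule inj_onI) (use qm in \<open>metis (mono_tags, lifting) mem_Collect_eq of_nat_eq_iff\<close>)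
    show "(\<lambda>m. int (m div ?q)) ` ?B \<subseteq> {\<lceil>x / real ?q\<rceil> .. \<lfloor>y / real ?q\<rfloor>}"
    proof
      fix j assume "j \<in> (\<lambda>m. int (m div ?q)) ` ?B"
      then obtain m where m: "m \<in> A (Suc n)" "x \<le> real m" "real m \<le> y" "j = int (m div ?q)"
        by auto
      then have "x \<le> of_int j * real ?q" "of_int j * real ?q \<le> y" using qm[OF m(1)] by auto
      then have "x / real ?q \<le> of_int j" "of_int j \<le> y / real ?q" using q0 by (auto simp: field_simps)
      then show "j \<in> {\<lceil>x / real ?q\<rceil> .. \<lfloor>y / real ?q\<rfloor>}" by (simp add: ceiling_le_iff le_floor_iff)
    qed
  qed simp
  also have "\<dots> = nat (\<lfloor>y / real ?q\<rfloor> - \<lceil>x / real ?q\<rceil> + 1)" by simp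
  finally have "real (card ?B) \<le> real (nat (\<lfloor>y / real ?q\<rfloor> - \<lceil>x / real ?q\<rceil> + 1))" by simp
  also have "\<dots> \<le> y / real ?q - x / real ?q + 1"
  proof -
    have "x / real ?q \<le> y / real ?q" using assms q0 by (simp add: divide_right_mono)
    then show ?thesis by linarith
  qed
  finally show ?thesis by (simp add: diff_divide_distrib)
qed

text \<open>
  An interval of length \<open>r\<close> meets few cells of level \<open>n + 1\<close>: their left endpoints are spaced by at
  least \<open>1 / (R n * d (n + 1))\<close>.
\<close>

lemma mass_interval:
  assumes "r \<ge> 0"
  shows "measure \<mu> {a..a + r} \<le> (r * real (R n) * real (d (Suc n)) + 2) / real (N (Suc n))"
proof -
  interpret T: real_distribution "tail (Suc n)" by (rule real_distribution_tail)
  let ?q = "q (Suc n)" and ?R = "real (R (Suc n))"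
  let ?x = "?R * a - 1" and ?y = "?R * (a + r)"
  let ?P = "\<lambda>m. ?x \<le> real m \<and> real m \<le> ?y"
  have R0: "?R > 0" by simp
  have "measure \<mu> {a..a + r} =
      (1 / real (N (Suc n))) * (\<Sum>m\<in>A (Suc n). measure (tail (Suc n)) {x. (real m + x) / ?R \<in> {a..a + r}})"
    by (rule prob_self_similar) auto
  also have "\<dots> \<le> (1 / real (N (Suc n))) * (\<Sum>m\<in>A (Suc n). if ?P m then 1 else 0)"
  proof (intro mult_left_mono sum_mono)
    fix m
    show "measure (tail (Suc n)) {x. (real m + x) / ?R \<in> {a..a + r}} \<le> (if ?P m then 1 else 0)"
    proof (cases "?P m")
      case False
      have "AE x in tail (Suc n). \<not> (real m + x) / ?R \<in> {a..a + r}"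
        using tail_support_unit[of "Suc n"]
      proof eventually_elim
        case (elim x)
        then show ?case using False R0 by (auto simp: field_simps)
      qed
      then have "measure (tail (Suc n)) {x\<in>space (tail (Suc n)). (real m + x) / ?R \<in> {a..a + r}} = 0"
        by (subst T.prob_eq_0) auto
      then show ?thesis using False by simp
    qed simp
  qed simp
  also have "(\<Sum>m\<in>A (Suc n). if ?P m then 1 else 0 :: real) = real (card {m \<in> A (Suc n). ?P m})"
    by (simp add: sum.If_cases Int_def)
  also have "(1 / real (N (Suc n))) * \<dots> \<le> (1 / real (N (Suc n))) * ((?y - ?x) / real ?q + 1)"
    using assms R0 by (intro mult_left_mono card_A_interval) (auto simp: algebra_simps)
  also have "(?y - ?x) / real ?q + 1 = r * (real (R n) * real (d (Suc n))) + 1 / real ?q + 1"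
    using q_ge[of "Suc n"] by (simp add: R_Suc b_eq[of "Suc n"] field_simps)
  also have "(1 / real (N (Suc n))) * \<dots> \<le> (1 / real (N (Suc n))) * (r * (real (R n) * real (d (Suc n))) + 2)"
    using q_ge[of "Suc n"] by (intro mult_left_mono) auto
  finally show ?thesis by (simp add: mult_ac)
qed

lemma mass_point: "measure \<mu> {a} = 0"
proof -
  have "(\<lambda>n. 2 / real (N (Suc n))) \<longlonglongrightarrow> 0"
    by (rule real_tendsto_divide_at_top[OF tendsto_const])
       (rule filterlim_compose[OF filterlim_N filterlim_Suc])
  moreover have "measure \<mu> {a} \<le> 2 / real (N (Suc n))" for n
    using mass_interval[of 0 a n] by simp
  ultimately have "measure \<mu> {a} \<le> 0"
    by (intro LIMSEQ_le_const) auto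
  then show ?thesis using measure_nonneg[of \<mu> "{a}"] by simp
qed

text \<open>
  With \<open>n\<close> chosen so that \<open>1 / R (n + 1) \<le> r < 1 / R n\<close> there are two regimes. If the interval is longer
  than the spacing of the cells of level \<open>n + 1\<close>, its mass grows linearly in \<open>r\<close> from the mass of a cell
  of level \<open>n\<close>, and \<open>r * R n \<le> (r * R n) powr s\<close> leads back to the hypothesis at \<open>n\<close>. Otherwise it
  meets a bounded number of cells, and the hypothesis at \<open>n + 1\<close> bounds the mass of each.
\<close>

lemma mass_interval_powr:
  assumes s: "0 \<le> s" "s \<le> 1" and B: "\<And>n. real (R n) powr s \<le> B * real (N n)"
    and r: "0 \<le> r" "r < 1"
  shows "measure \<mu> {a..a + r} \<le> 3 * B * r powr s"
proof (cases "r = 0")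
  case True
  then show ?thesis using mass_point[of a] by simp
next
  case False
  then have r0: "r > 0" using r by simp
  have "\<exists>n. 1 / real (R n) \<le> r"
  proof -
    have "\<forall>\<^sub>F n in sequentially. real (R n) \<ge> 1 / r"
      using filterlim_R by (simp add: filterlim_at_top)
    then obtain n where "real (R n) \<ge> 1 / r" by (auto simp: eventually_sequentially)
    then show ?thesis using r0 R_pos[of n] by (intro exI[of _ n]) (simp add: field_simps)
  qed
  moreover have "\<not> 1 / real (R 0) \<le> r" using r by simp
  ultimately obtain n where n: "1 / real (R (Suc n)) \<le> r" "\<not> 1 / real (R n) \<le> r"
    using ex_least_nat_less[of "\<lambda>n. 1 / real (R n) \<le> r"] by blast
  have "B \<ge> 1" using B[of 0] by simp
  have lower: "1 \<le> B * real (N k) * r powr s" if "1 / real (R k) \<le> r" for k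
  proof -
    have "1 = real (R k) powr s * (1 / real (R k)) powr s"
      by (simp add: powr_mult[symmetric])
    also have "\<dots> \<le> (B * real (N k)) * r powr s"
      using that s \<open>B \<ge> 1\<close> by (intro mult_mono B powr_mono2) auto
    finally show ?thesis .
  qed
  have N0: "real (N n) > 0" "real (N (Suc n)) > 0" "real (R n) > 0" "real (d (Suc n)) > 0"
    using d_ge[of "Suc n"] by auto
  show ?thesis
  proof (cases "1 \<le> r * real (R n) * real (d (Suc n))")
    case True
    have "measure \<mu> {a..a + r} \<le> (r * real (R n) * real (d (Suc n)) + 2) / real (N (Suc n))"
      by (rule mass_interval[OF r(1)])
    also have "\<dots> \<le> (3 * (r * real (R n) * real (d (Suc n)))) / real (N (Suc n))"
      using True by (intro divide_right_mono) auto
    also have "\<dots> = 3 * (r * real (R n)) / real (N n)"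
      using N0 by (simp add: N_Suc field_simps)
    also have "\<dots> \<le> 3 * (r * real (R n)) powr s / real (N n)"
    proof -
      have "r * real (R n) < 1" using n(2) N0 by (simp add: field_simps)
      then have "(r * real (R n)) powr 1 \<le> (r * real (R n)) powr s"
        using s r0 by (intro powr_mono') auto
      then show ?thesis using r0 N0 by (intro divide_right_mono) auto
    qed
    also have "\<dots> = 3 * r powr s * (real (R n) powr s / real (N n))"
      using r0 by (simp add: powr_mult)
    also have "\<dots> \<le> 3 * r powr s * B"
      using B[of n] N0 by (intro mult_left_mono) (auto simp: field_simps)
    finally show ?thesis by (simp add: mult_ac)
  next
    case False
    have "measure \<mu> {a..a + r} \<le> (r * real (R n) * real (d (Suc n)) + 2) / real (N (Suc n))"
      by (rule mass_interval[OF r(1)])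
    also have "\<dots> \<le> 3 * 1 / real (N (Suc n))"
      using False by (intro divide_right_mono) auto
    also have "\<dots> \<le> 3 * (B * real (N (Suc n)) * r powr s) / real (N (Suc n))"
      using lower[OF n(1)] by (intro divide_right_mono) auto
    also have "\<dots> = 3 * B * r powr s" using N0(2) by (simp del: N_pos)
    finally show ?thesis .
  qed
qed

lemma log_ratio_step:
  "(s * ln (real (R (Suc n))) - ln (real (N (Suc n)))) =
   (s * ln (real (R n)) - ln (real (N n))) +
     ln (real (b (Suc n))) * (s - ln (real (d (Suc n))) / ln (real (b (Suc n))))"
proof -
  have "real (b (Suc n)) \<ge> 4" "real (d (Suc n)) > 0" "real (R n) > 0" "real (N n) > 0"
    using b_ge4[of "Suc n"] d_ge[of "Suc n"] by auto
  then show ?thesis by (simp add: R_Suc N_Suc ln_mult field_simps)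
qed

lemma ln_b_ge: "ln (real (b (Suc n))) \<ge> ln 4"
  using b_ge4[of "Suc n"] by simp

text \<open>
  Describing the carrier by floors avoids closures and makes it visibly a Borel set.
\<close>

definition cantor_set :: "real set" where
  "cantor_set = {x. \<forall>n. \<lfloor>real (R n) * x\<rfloor> \<in> int ` A n}"

lemma cantor_set_measurable: "cantor_set \<in> sets borel"
proof -
  have "{x::real. \<lfloor>real (R n) * x\<rfloor> \<in> int ` A n} \<in> sets borel" for n
    by measurable
  then have "(\<Inter>n. {x::real. \<lfloor>real (R n) * x\<rfloor> \<in> int ` A n}) \<in> sets borel" by auto
  also have "(\<Inter>n. {x::real. \<lfloor>real (R n) * x\<rfloor> \<in> int ` A n}) = cantor_set"
    by (auto simp: cantor_set_def)
  finally show ?thesis .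
qed

lemma emeasure_cantor_set: "emeasure \<mu> cantor_set = 1"
proof -
  interpret M: real_distribution \<mu> by (rule real_distribution_\<mu>)
  have "AE x in \<mu>. \<lfloor>real (R n) * x\<rfloor> \<in> int ` A n" for n
  proof (rule AE_self_similar[of _ n])
    fix m assume m: "m \<in> A n"
    show "AE x in tail n. \<lfloor>real (R n) * ((real m + x) / real (R n))\<rfloor> \<in> int ` A n"
      using tail_support[of n]
    proof eventually_elim
      case (elim x)
      then have "\<lfloor>real (R n) * ((real m + x) / real (R n))\<rfloor> = int m"
        by (simp add: floor_eq_iff)
      then show ?case using m by simp
    qed
  qed measurable
  then have "AE x in \<mu>. x \<in> cantor_set"
    unfolding cantor_set_def by (simp add: AE_all_countable)
  then show ?thesis
    using cantor_set_measurable by (intro M.emeasure_eq_1_AE) auto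
qed

lemma hausdorff_pre_cantor_set:
  assumes s: "s > 0" and \<delta>: "1 / real (R n) \<le> \<delta>"
  shows "hausdorff_pre s \<delta> cantor_set \<le> ennreal (real (N n) * (1 / real (R n)) powr s)"
proof -
  obtain h where h: "bij_betw h {0..<N n} (A n)"
    using ex_bij_betw_nat_finite[OF A_finite, of n] by (auto simp: A_card)
  define U where "U i = (if i < N n then {real (h i) / real (R n) .. (real (h i) + 1) / real (R n)} else {})" for i
  have R0: "real (R n) > 0" by simp
  have cover: "cantor_set \<subseteq> (\<Union>i. U i)"
  proof
    fix x assume "x \<in> cantor_set"
    then obtain m where m: "m \<in> A n" "\<lfloor>real (R n) * x\<rfloor> = int m" by (auto simp: cantor_set_def)
    then have "m \<in> h ` {0..<N n}" using h by (simp add: bij_betw_def)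
    then obtain i where i: "i < N n" "h i = m" by auto
    have "real m \<le> real (R n) * x" "real (R n) * x < real m + 1"
      using m(2) by (auto simp: floor_eq_iff)
    then have "x \<in> U i" using R0 i by (auto simp: U_def field_simps)
    then show "x \<in> (\<Union>i. U i)" by blast
  qed
  have bdd: "bounded (U i)" for i by (simp add: U_def)
  have diam: "diameter (U i) \<le> 1 / real (R n)" for i
  proof (rule diameter_le)
    fix x y assume "x \<in> U i" "y \<in> U i"
    then have "\<bar>x - y\<bar> \<le> (real (h i) + 1) / real (R n) - real (h i) / real (R n)"
      by (auto simp: U_def split: if_splits)
    then show "norm (x - y) \<le> 1 / real (R n)" by (simp add: add_divide_distrib)
  qed simp
  have dp: "diam_powr s (U i) \<le> ennreal ((1 / real (R n)) powr s)" for i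
    using s diam[of i] bdd[of i] by (auto simp: diam_powr_def intro!: ennreal_leI powr_mono2 diameter_ge_0)
  have "hausdorff_pre s \<delta> cantor_set \<le> (\<Sum>i. diam_powr s (U i))"
    unfolding hausdorff_pre_def
    by (rule Inf_lower) (use cover bdd order_trans[OF diam \<delta>] in blast)
  also have "\<dots> = (\<Sum>i<N n. diam_powr s (U i))"
    by (rule suminf_finite) (auto simp: U_def diam_powr_def)
  also have "\<dots> \<le> (\<Sum>i<N n. ennreal ((1 / real (R n)) powr s))"
    by (intro sum_mono dp)
  also have "\<dots> = ennreal (real (N n) * (1 / real (R n)) powr s)"
    by (simp add: ennreal_mult ennreal_of_nat_eq_real_of_nat)
  finally show ?thesis .
qed

context
  fixes \<alpha> :: real
  assumes lim: "(\<lambda>n. ln (real (d n)) / ln (real (b n))) \<longlonglongrightarrow> \<alpha>"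
begin

lemma R_powr_bounded:
  assumes "s < \<alpha>"
  shows "\<exists>B\<ge>1. \<forall>n. real (R n) powr s \<le> B * real (N n)"
proof -
  let ?S = "\<lambda>n. s * ln (real (R n)) - ln (real (N n))"
  have "\<forall>\<^sub>F n in sequentially. s < ln (real (d (Suc n))) / ln (real (b (Suc n)))"
    using LIMSEQ_Suc[OF lim] assms by (rule order_tendstoD)
  then have "\<forall>\<^sub>F n in sequentially. ?S (Suc n) \<le> ?S n"
  proof eventually_elim
    case (elim n)
    have "ln (real (b (Suc n))) > 0" using b_ge4[of "Suc n"] by simp
    then have "ln (real (b (Suc n))) * (s - ln (real (d (Suc n))) / ln (real (b (Suc n)))) \<le> 0"
      using elim by (intro mult_nonneg_nonpos) auto
    then show ?case unfolding log_ratio_step by simp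
  qed
  from partial_sums_bdd_above[OF this] obtain B where B: "\<And>n. ?S n \<le> B" by blast
  have "real (R n) powr s \<le> max 1 (exp B) * real (N n)" for n
  proof -
    have "real (R n) powr s = exp (?S n) * real (N n)"
      using R_pos[of n] N_pos[of n] by (simp add: powr_def exp_diff)
    also have "\<dots> \<le> max 1 (exp B) * real (N n)"
      using B[of n] by (intro mult_right_mono) (auto simp: le_max_iff_disj)
    finally show ?thesis .
  qed
  then show ?thesis by (intro exI[of _ "max 1 (exp B)"]) auto
qed

lemma N_over_R_powr_tendsto_0:
  assumes "\<alpha> < s"
  shows "(\<lambda>n. real (N n) * (1 / real (R n)) powr s) \<longlonglongrightarrow> 0"
proof -
  let ?S = "\<lambda>n. s * ln (real (R n)) - ln (real (N n))"
  let ?t = "(\<alpha> + s) / 2"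
  have "\<forall>\<^sub>F n in sequentially. ln (real (d (Suc n))) / ln (real (b (Suc n))) < ?t"
    using LIMSEQ_Suc[OF lim] assms by (intro order_tendstoD) auto
  then have "\<forall>\<^sub>F n in sequentially. ?S (Suc n) \<ge> ?S n + ln 4 * ((s - \<alpha>) / 2)"
  proof eventually_elim
    case (elim n)
    have "ln 4 * ((s - \<alpha>) / 2) \<le>
        ln (real (b (Suc n))) * (s - ln (real (d (Suc n))) / ln (real (b (Suc n))))"
      using elim assms ln_b_ge[of n] ln_gt_zero[of "4::real"]
      by (intro mult_mono) (auto simp: field_simps intro: order_trans[of _ "ln 4"])
    then show ?case unfolding log_ratio_step by simp
  qed
  then have "filterlim ?S at_top sequentially"
    using assms by (intro partial_sums_at_top[of "ln 4 * ((s - \<alpha>) / 2)"]) auto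
  then have "(\<lambda>n. exp (- ?S n)) \<longlonglongrightarrow> 0"
    by (intro filterlim_compose[OF exp_at_bot]) (simp only: filterlim_uminus_at_bot minus_minus)
  also have "(\<lambda>n. exp (- ?S n)) = (\<lambda>n. real (N n) * (1 / real (R n)) powr s)"
  proof
    fix n
    have "- ?S n = ln (real (N n)) + s * - ln (real (R n))" by simp
    then have "exp (- ?S n) = exp (ln (real (N n))) * exp (s * - ln (real (R n)))"
      by (simp only: exp_add)
    also have "- ln (real (R n)) = ln (1 / real (R n))" by (simp add: ln_div)
    finally show "exp (- ?S n) = real (N n) * (1 / real (R n)) powr s"
      by (simp add: powr_def less_imp_neq[OF R_pos, symmetric])
  qed
  finally show ?thesis .
qed

lemma hausdorff_measure_cantor_set:
  assumes "\<alpha> < s" "s > 0"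
  shows "hausdorff_measure s cantor_set = 0"
proof -
  have "hausdorff_pre s \<delta> cantor_set = 0" if \<delta>: "\<delta> > 0" for \<delta>
  proof -
    have "\<forall>\<^sub>F n in sequentially. real (R n) \<ge> 1 / \<delta>"
      using filterlim_R by (simp add: filterlim_at_top)
    then have "\<forall>\<^sub>F n in sequentially. hausdorff_pre s \<delta> cantor_set \<le>
        ennreal (real (N n) * (1 / real (R n)) powr s)"
    proof eventually_elim
      case (elim n)
      then show ?case
        using \<delta> R_pos[of n] by (intro hausdorff_pre_cantor_set assms(2)) (simp add: field_simps)
    qed
    moreover have "(\<lambda>n. ennreal (real (N n) * (1 / real (R n)) powr s)) \<longlonglongrightarrow> ennreal 0"
      by (intro tendsto_ennrealI N_over_R_powr_tendsto_0 assms)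
    ultimately have "hausdorff_pre s \<delta> cantor_set \<le> ennreal 0"
      by (intro tendsto_lowerbound[of _ _ sequentially]) auto
    then show ?thesis by simp
  qed
  then show ?thesis unfolding hausdorff_measure_def by (simp add: SUP_eq_const)
qed

theorem hausdorff_dim_\<mu>:
  assumes \<alpha>: "0 \<le> \<alpha>" "\<alpha> \<le> 1"
  shows "hausdorff_dim_measure \<mu> = ennreal \<alpha>"
proof (rule antisym)
  interpret M: real_distribution \<mu> by (rule real_distribution_\<mu>)
  have "hausdorff_dim_measure \<mu> \<le> hausdorff_dim cantor_set"
    unfolding hausdorff_dim_measure_def
    by (rule Inf_lower) (use cantor_set_measurable emeasure_cantor_set in auto)
  also have "\<dots> \<le> ennreal \<alpha>"
  proof (rule ennreal_le_epsilon)
    fix e :: real assume e: "0 < e"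
    have "hausdorff_dim cantor_set \<le> ennreal (\<alpha> + e)"
      unfolding hausdorff_dim_def
      by (rule Inf_lower, intro CollectI exI[of _ "\<alpha> + e"])
         (use e \<alpha> hausdorff_measure_cantor_set[of "\<alpha> + e"] in simp)
    then show "hausdorff_dim cantor_set \<le> ennreal \<alpha> + ennreal e"
      using e \<alpha> by (simp add: ennreal_plus)
  qed
  finally show "hausdorff_dim_measure \<mu> \<le> ennreal \<alpha>" .
next
  show "ennreal \<alpha> \<le> hausdorff_dim_measure \<mu>"
    unfolding hausdorff_dim_measure_def
  proof (rule Inf_greatest, clarify)
    fix E assume E: "E \<in> sets \<mu>" "emeasure \<mu> E = 1"
    show "ennreal \<alpha> \<le> hausdorff_dim E"
      unfolding hausdorff_dim_def
    proof (rule Inf_greatest, clarify)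
      fix s :: real assume s: "0 \<le> s" "hausdorff_measure s E = 0"
      have "\<not> s < \<alpha>"
      proof
        assume "s < \<alpha>"
        then obtain B where B: "B \<ge> 1" "\<And>n. real (R n) powr s \<le> B * real (N n)"
          using R_powr_bounded by blast
        have "hausdorff_measure s E \<noteq> 0"
        proof (rule mass_distribution_principle[OF real_distribution_\<mu> _ s(1) _ E])
          show "3 * B \<ge> 1" using B(1) by simp
          show "measure \<mu> {a..a + r} \<le> 3 * B * r powr s" if "0 \<le> r" "r < 1" for a r
            using s(1) \<open>s < \<alpha>\<close> \<alpha>(2) that by (intro mass_interval_powr B(2)) auto
        qed
        then show False using s by simp
      qed
      then show "ennreal \<alpha> \<le> ennreal s" by (intro ennreal_leI) simp
    qed
  qed
qed

end

end

theorem corollary1p3: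
  fixes \<alpha> :: real and b d :: "nat \<Rightarrow> nat"
  assumes "0 \<le> \<alpha>" and "\<alpha> \<le> 1"
    and "\<And>n. n \<ge> 1 \<Longrightarrow> 1 < d n \<and> d n < b n"
    and "\<And>n. n \<ge> 1 \<Longrightarrow> 2 \<le> real (b n) / real (d n) \<and> real (b n) / real (d n) \<in> \<int>"
    and "filterlim d at_top sequentially"
    and "(\<lambda>n. ln (real (d n)) / ln (real (b n))) \<longlonglongrightarrow> \<alpha>"
  shows "spectral_measure (riesz_product_measure b d) \<and>
         hausdorff_dim_measure (riesz_product_measure b d) = ennreal \<alpha>"
proof -
  interpret riesz_sequences b d
  proof
    fix n :: nat assume n: "n \<ge> 1"
    then have d0: "real (d n) > 0" using assms(3)[OF n] by simp
    show "2 \<le> d n" using assms(3)[OF n] by simp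
    have "2 * real (d n) \<le> real (b n)" using assms(4)[OF n] d0 by (simp add: field_simps)
    then show "2 * d n \<le> b n" by linarith
    obtain k :: int where "real (b n) / real (d n) = of_int k"
      using assms(4)[OF n] by (auto elim: Ints_cases)
    then have "real_of_int (int (b n)) = real_of_int (k * int (d n))" using d0 by (simp add: field_simps)
    then have "int (b n) = k * int (d n)" by (simp only: of_int_eq_iff)
    then have "int (d n) dvd int (b n)" by simp
    then show "d n dvd b n" by (simp only: of_nat_dvd_iff)
  qed
  show ?thesis using spectral_\<mu> hausdorff_dim_\<mu>[OF assms(6,1,2)] by simp
qed

end
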